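(* Let $V$ be a complex Banach space, $A$ a bounded linear operator on $V$ with resolvent set $\rho(A)$, and suppose that the resolvent function $z\mapsto(z-A)^{-1}$, $z\in\rho(A)$, can be extended to an $L(V)$-valued resolvent distribution $R$ defined on the whole complex plane. Let $M=\frac1\pi\overline{\partial}R$ be the spectral Schwartz distribution of $R$. Then the support of $M$ is compact, so that $M(1)$ is defined (with $1$ the constant function $1$), and $$M(1)=\int M(z)\,d^2z=1_{L(V)}.$$
   Context: $L(V)$ is the Banach algebra of bounded operators on $V$ with the operator norm and $1_{L(V)}$ its identity. $\mathcal{D}(\mathbb{C})$ is the space of complex-valued $C^\infty$ functions with compact support on $\mathbb{C}$. An $L(V)$-valued distribution on $\mathbb{C}$ is a linear map $T:\mathcal{D}(\mathbb{C})\to L(V)$, continuous in the usual sense of distributions with respect to the operator norm; one writes $T(\varphi)=\int T(z)\varphi(z)\,d^2z$, $d^2z=dx\,dy$ for $z=x+iy$. Put $\overline{\partial}=\frac12(\partial_x+i\partial_y)$ and $(\overline{\partial}T)(\varphi)=-T(\overline{\partial}\varphi)$. $R$ is a resolvent distribution on $\mathbb{C}$ if for all $\varphi_1,\varphi_2\in\mathcal{D}(\mathbb{C})$ $$R(\varphi_1)R(\varphi_2)=\int d^2z_1\,R(z_1)\varphi_1(z_1)\int d^2z_2\frac{\varphi_2(z_2)}{z_2-z_1}-\int d^2z_2\,R(z_2)\varphi_2(z_2)\int d^2z_1\frac{\varphi_1(z_1)}{z_2-z_1}.$$ That $R$ extends the resolvent function means $R(\varphi)=\int\varphi(z)(z-A)^{-1}d^2z$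 for all $\varphi\in\mathcal{D}(\mathbb{C})$ with support in $\rho(A)$. For a distribution $M$ with compact support, $M(1):=M(\varphi)$ for any $\varphi\in\mathcal{D}(\mathbb{C})$ equal to $1$ on a neighbourhood of the support of $M$. *)

theory Defs
  imports "HOL-Analysis.Analysis"
begin

section \<open>Complex Banach spaces\<close>

class scaleC =
  fixes scaleC :: "complex \<Rightarrow> 'a \<Rightarrow> 'a"  (infixr \<open>*\<^sub>C\<close> 75)

class complex_vector = real_vector + scaleC +
  assumes scaleC_add_right: "c *\<^sub>C (x + y) = c *\<^sub>C x + c *\<^sub>C y"
    and scaleC_add_left: "(c + d) *\<^sub>C x = c *\<^sub>C x + d *\<^sub>C x"
    and scaleC_scaleC: "c *\<^sub>C d *\<^sub>C x = (c * d) *\<^sub>C x"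
    and scaleC_one: "1 *\<^sub>C x = x"
    and scaleR_scaleC: "r *\<^sub>R x = complex_of_real r *\<^sub>C x"

class complex_normed_vector = complex_vector + real_normed_vector +
  assumes norm_scaleC: "norm (c *\<^sub>C x) = norm c * norm x"

class complex_banach = complex_normed_vector + banach

instantiation complex :: complex_banach
begin

definition scaleC_complex :: "complex \<Rightarrow> complex \<Rightarrow> complex"
  where "scaleC_complex c x = c * x"

instance
  by standard
    (simp_all add: scaleC_complex_def algebra_simps norm_mult scaleR_conv_of_real)

end

lemma bounded_linear_scaleC: "bounded_linear (\<lambda>x::'a::complex_normed_vector. c *\<^sub>C x)"
proof (rule bounded_linear_intro)
  show "c *\<^sub>C (r *\<^sub>R x) = r *\<^sub>R (c *\<^sub>C x)" for r and x :: 'a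
    by (simp add: scaleR_scaleC scaleC_scaleC mult.commute)
  show "norm (c *\<^sub>C x) \<le> norm x * norm c" for x :: 'a
    by (simp add: norm_scaleC mult.commute)
qed (rule scaleC_add_right)

instantiation blinfun :: (real_normed_vector, complex_normed_vector) complex_normed_vector
begin

lift_definition scaleC_blinfun ::
  "complex \<Rightarrow> 'a \<Rightarrow>\<^sub>L 'b \<Rightarrow> 'a \<Rightarrow>\<^sub>L 'b" is "\<lambda>c f x. c *\<^sub>C f x"
  by (rule bounded_linear_compose[OF bounded_linear_scaleC])

instance
proof
  fix c d :: complex and r :: real and f g :: "'a \<Rightarrow>\<^sub>L 'b"
  show "c *\<^sub>C (f + g) = c *\<^sub>C f + c *\<^sub>C g"
    by transfer (simp add: scaleC_add_right)
  show "(c + d) *\<^sub>C f = c *\<^sub>C f + d *\<^sub>C f"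
    by transfer (simp add: scaleC_add_left)
  show "c *\<^sub>C d *\<^sub>C f = (c * d) *\<^sub>C f"
    by transfer (simp add: scaleC_scaleC)
  show "1 *\<^sub>C f = f"
    by transfer (simp add: scaleC_one)
  show "r *\<^sub>R f = complex_of_real r *\<^sub>C f"
    by transfer (simp add: scaleR_scaleC)
  have le: "norm (a *\<^sub>C h) \<le> norm a * norm h" for a and h :: "'a \<Rightarrow>\<^sub>L 'b"
    by (rule norm_blinfun_bound)
      (auto simp: scaleC_blinfun.rep_eq norm_scaleC mult.assoc
        intro!: mult_left_mono norm_blinfun)
  show "norm (c *\<^sub>C f) = norm c * norm f"
  proof (cases "c = 0")
    case True
    then show ?thesis using le[of 0 f] by simp
  next
    case False
    have "inverse c *\<^sub>C c *\<^sub>C f = f"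
      using False by transfer (simp add: scaleC_scaleC scaleC_one)
    then have "norm f \<le> inverse (norm c) * norm (c *\<^sub>C f)"
      using le[of "inverse c" "c *\<^sub>C f"] by (simp add: norm_inverse)
    then have "norm c * norm f \<le> norm (c *\<^sub>C f)"
      using False by (simp add: field_simps)
    then show ?thesis using le[of c f] by simp
  qed
qed

end

instance blinfun :: (real_normed_vector, complex_banach) complex_banach ..

section \<open>Bounded operators and the resolvent\<close>

text \<open>Elements of \<^typ>\<open>'v \<Rightarrow>\<^sub>L 'v\<close> are only real-linear, so the algebra \<open>L(V)\<close> is the
  subspace of the complex-linear ones.\<close>

definition bounded_operators :: "('v::complex_normed_vector \<Rightarrow>\<^sub>L 'v) set"
  where "bounded_operators =
    {T. \<forall>c x. blinfun_apply T (c *\<^sub>C x) = c *\<^sub>C blinfun_apply T x}"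

definition is_resolvent ::
  "('v::complex_normed_vector \<Rightarrow>\<^sub>L 'v) \<Rightarrow> complex \<Rightarrow> ('v \<Rightarrow>\<^sub>L 'v) \<Rightarrow> bool"
  where "is_resolvent A z B \<longleftrightarrow> B \<in> bounded_operators
    \<and> (z *\<^sub>C id_blinfun - A) o\<^sub>L B = id_blinfun
    \<and> B o\<^sub>L (z *\<^sub>C id_blinfun - A) = id_blinfun"

definition resolvent_set :: "('v::complex_normed_vector \<Rightarrow>\<^sub>L 'v) \<Rightarrow> complex set"
  where "resolvent_set A = {z. \<exists>B. is_resolvent A z B}"

definition resolvent :: "('v::complex_normed_vector \<Rightarrow>\<^sub>L 'v) \<Rightarrow> complex \<Rightarrow> 'v \<Rightarrow>\<^sub>L 'v"
  where "resolvent A z = (THE B. is_resolvent A z B)"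

section \<open>Test functions\<close>

text \<open>Here \<open>differentiable\<close> and \<open>frechet_derivative\<close> refer to the real-linear derivative on
  \<open>\<complex> = \<real>\<^sup>2\<close>, so these are the partial derivatives in \<open>x\<close> and \<open>y\<close>.\<close>

definition dx :: "(complex \<Rightarrow> complex) \<Rightarrow> complex \<Rightarrow> complex"
  where "dx f z = frechet_derivative f (at z) 1"

definition dy :: "(complex \<Rightarrow> complex) \<Rightarrow> complex \<Rightarrow> complex"
  where "dy f z = frechet_derivative f (at z) \<i>"

definition dbar :: "(complex \<Rightarrow> complex) \<Rightarrow> complex \<Rightarrow> complex"
  where "dbar f z = (dx f z + \<i> * dy f z) / 2"

primrec Ck :: "nat \<Rightarrow> (complex \<Rightarrow> complex) \<Rightarrow> bool"
  where
    "Ck 0 f \<longleftrightarrow> continuous_on UNIV f"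
  | "Ck (Suc k) f \<longleftrightarrow> (\<forall>z. f differentiable (at z)) \<and> Ck k (dx f) \<and> Ck k (dy f)"

definition fun_support :: "(complex \<Rightarrow> complex) \<Rightarrow> complex set"
  where "fun_support f = closure {z. f z \<noteq> 0}"

definition test_functions :: "(complex \<Rightarrow> complex) set"
  where "test_functions = {\<phi>. (\<forall>k. Ck k \<phi>) \<and> compact (fun_support \<phi>)}"

section \<open>Operator-valued distributions\<close>

text \<open>A distribution is a function on all of \<^typ>\<open>complex \<Rightarrow> complex\<close> of which only the values on
  test functions matter. Continuity is the usual seminorm estimate on each compact set.\<close>

definition operator_distribution ::
  "((complex \<Rightarrow> complex) \<Rightarrow> 'v::complex_normed_vector \<Rightarrow>\<^sub>L 'v) \<Rightarrow> bool"
  where "operator_distribution T \<longleftrightarrow>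
    (\<forall>\<phi>\<in>test_functions. T \<phi> \<in> bounded_operators)
    \<and> (\<forall>\<phi>\<in>test_functions. \<forall>\<psi>\<in>test_functions. T (\<lambda>z. \<phi> z + \<psi> z) = T \<phi> + T \<psi>)
    \<and> (\<forall>c. \<forall>\<phi>\<in>test_functions. T (\<lambda>z. c * \<phi> z) = c *\<^sub>C T \<phi>)
    \<and> (\<forall>K. compact K \<longrightarrow> (\<exists>C N. \<forall>\<phi>\<in>test_functions. fun_support \<phi> \<subseteq> K \<longrightarrow>
          norm (T \<phi>) \<le> C * (\<Sum>k\<le>N. \<Sum>i\<le>k. SUP z. norm ((dx ^^ i) ((dy ^^ (k - i)) \<phi>) z))))"

definition dist_support ::
  "((complex \<Rightarrow> complex) \<Rightarrow> 'v::complex_normed_vector \<Rightarrow>\<^sub>L 'v) \<Rightarrow> complex set"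
  where "dist_support T = - \<Union>{U. open U \<and>
    (\<forall>\<phi>\<in>test_functions. fun_support \<phi> \<subseteq> U \<longrightarrow> T \<phi> = 0)}"

definition dist_dbar ::
  "((complex \<Rightarrow> complex) \<Rightarrow> 'v::complex_normed_vector \<Rightarrow>\<^sub>L 'v)
    \<Rightarrow> (complex \<Rightarrow> complex) \<Rightarrow> 'v \<Rightarrow>\<^sub>L 'v"
  where "dist_dbar T \<phi> = - T (dbar \<phi>)"

definition cutoff_functions :: "complex set \<Rightarrow> (complex \<Rightarrow> complex) set"
  where "cutoff_functions S =
    {\<psi>\<in>test_functions. \<exists>U. open U \<and> S \<subseteq> U \<and> (\<forall>z\<in>U. \<psi> z = 1)}"

text \<open>\<open>T(1)\<close> is defined and equal to \<open>B\<close>: cutoff functions exist, and \<open>T\<close> has the value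
  \<open>B\<close> on every one of them.\<close>

definition has_value_at_one ::
  "((complex \<Rightarrow> complex) \<Rightarrow> 'v::complex_normed_vector \<Rightarrow>\<^sub>L 'v) \<Rightarrow> 'v \<Rightarrow>\<^sub>L 'v \<Rightarrow> bool"
  where "has_value_at_one T B \<longleftrightarrow> cutoff_functions (dist_support T) \<noteq> {}
    \<and> (\<forall>\<psi>\<in>cutoff_functions (dist_support T). T \<psi> = B)"

section \<open>Resolvent distributions\<close>

text \<open>The Cauchy kernel is locally Lebesgue integrable; its value at the singularity, which is
  \<open>0\<close> by the convention on division, does not matter.\<close>

definition resolvent_distribution ::
  "((complex \<Rightarrow> complex) \<Rightarrow> 'v::complex_normed_vector \<Rightarrow>\<^sub>L 'v) \<Rightarrow> bool"
  where "resolvent_distribution R \<longleftrightarrow> operator_distribution R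
    \<and> (\<forall>\<phi>\<^sub>1\<in>test_functions. \<forall>\<phi>\<^sub>2\<in>test_functions.
        R \<phi>\<^sub>1 o\<^sub>L R \<phi>\<^sub>2 =
          R (\<lambda>z\<^sub>1. \<phi>\<^sub>1 z\<^sub>1 * (LINT z\<^sub>2|lborel. \<phi>\<^sub>2 z\<^sub>2 / (z\<^sub>2 - z\<^sub>1)))
          - R (\<lambda>z\<^sub>2. \<phi>\<^sub>2 z\<^sub>2 * (LINT z\<^sub>1|lborel. \<phi>\<^sub>1 z\<^sub>1 / (z\<^sub>2 - z\<^sub>1))))"

text \<open>Operator-valued integrals are Henstock--Kurzweil integrals, since the library's Bochner
  integral requires a separable range. The integrand is continuous with compact support.\<close>

definition extends_resolvent ::
  "('v::complex_banach \<Rightarrow>\<^sub>L 'v) \<Rightarrow> ((complex \<Rightarrow> complex) \<Rightarrow> 'v \<Rightarrow>\<^sub>L 'v) \<Rightarrow> bool"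
  where "extends_resolvent A R \<longleftrightarrow>
    (\<forall>\<phi>\<in>test_functions. fun_support \<phi> \<subseteq> resolvent_set A \<longrightarrow>
      ((\<lambda>z. \<phi> z *\<^sub>C resolvent A z) has_integral R \<phi>) UNIV)"

definition spectral_distribution ::
  "((complex \<Rightarrow> complex) \<Rightarrow> 'v::complex_normed_vector \<Rightarrow>\<^sub>L 'v)
    \<Rightarrow> (complex \<Rightarrow> complex) \<Rightarrow> 'v \<Rightarrow>\<^sub>L 'v"
  where "spectral_distribution R \<phi> = (1 / complex_of_real pi) *\<^sub>C dist_dbar R \<phi>"

end

theory Submission imports Defs begin

text \<open>For \<open>|z| > \<parallel>A\<parallel>\<close> the resolvent is the Laurent series \<open>\<Sum>n. A\<^sup>n / z\<^sup>n\<^sup>+\<^sup>1\<close>, so for a test function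
  \<open>\<phi>\<close> supported there, \<open>R \<phi>\<close> is determined by the moments \<open>\<integral> \<phi> z / z\<^sup>n\<^sup>+\<^sup>1\<close>. If \<open>\<phi>\<close> is the
  \<open>dbar\<close>-derivative of a test function supported there, all moments vanish by Stokes, which bounds the
  support of \<open>M\<close>. If \<open>\<phi> = dbar \<kappa>\<close> for a radial cutoff function \<open>\<kappa>\<close>, rotation invariance kills the
  moments with \<open>n > 0\<close> and integration in the variable \<open>|z|\<^sup>2\<close> gives \<open>- \<pi>\<close> for \<open>n = 0\<close>, whence
  \<open>M \<kappa> = 1\<close>. Any other cutoff function differs from \<open>\<kappa>\<close> by a test function supported off the support
  of \<open>M\<close>.\<close>

section \<open>Differentiation of test functions\<close>

lemma dx_eq: "(f has_derivative f') (at z) \<Longrightarrow> dx f z = f' 1"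
  and dy_eq: "(f has_derivative f') (at z) \<Longrightarrow> dy f z = f' \<i>"
  by (simp_all add: dx_def dy_def frechet_derivative_at[symmetric])

text \<open>A real-linear map on \<complex> is determined by its values at \<open>1\<close> and
  \<open>\<i>\<close>. In this form one derivative rule yields the rules for \<open>dx\<close> and
  \<open>dy\<close> together.\<close>

lemma has_derivative_dx_dy:
  assumes "f differentiable (at z)"
  shows "(f has_derivative (\<lambda>v. Re v *\<^sub>R dx f z + Im v *\<^sub>R dy f z)) (at z)"
proof -
  let ?D = "frechet_derivative f (at z)"
  have D: "(f has_derivative ?D) (at z)"
    using assms by (simp add: frechet_derivative_works)
  then interpret bounded_linear ?D by (rule has_derivative_bounded_linear)
  have "?D v = Re v *\<^sub>R dx f z + Im v *\<^sub>R dy f z" for v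
  proof -
    have "v = Re v *\<^sub>R 1 + Im v *\<^sub>R \<i>"
      by (simp add: complex_eq_iff)
    then have "?D v = ?D (Re v *\<^sub>R 1 + Im v *\<^sub>R \<i>)" by simp
    then show ?thesis by (simp only: add scale dx_def dy_def)
  qed
  then have "?D = (\<lambda>v. Re v *\<^sub>R dx f z + Im v *\<^sub>R dy f z)" by (rule ext)
  with D show ?thesis by simp
qed

lemma dx_dy_const [simp]: "dx (\<lambda>z. c) = (\<lambda>z. 0)" "dy (\<lambda>z. c) = (\<lambda>z. 0)"
  by (auto simp: dx_def dy_def)

lemma dx_dy_add:
  assumes "f differentiable (at z)" "g differentiable (at z)"
  shows "dx (\<lambda>z. f z + g z) z = dx f z + dx g z" "dy (\<lambda>z. f z + g z) z = dy f z + dy g z"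
  using has_derivative_add[OF assms[THEN has_derivative_dx_dy]]
  by (simp_all add: dx_eq dy_eq)

lemma dx_dy_mult:
  assumes "f differentiable (at z)" "g differentiable (at z)"
  shows "dx (\<lambda>z. f z * g z) z = dx f z * g z + f z * dx g z"
    and "dy (\<lambda>z. f z * g z) z = dy f z * g z + f z * dy g z"
  using has_derivative_mult[OF assms[THEN has_derivative_dx_dy]]
  by (simp_all add: dx_eq dy_eq)

section \<open>Closure properties of \<open>Ck\<close>\<close>

lemma Ck_continuous: "Ck k f \<Longrightarrow> continuous_on UNIV f"
  by (cases k) (auto intro: continuous_at_imp_continuous_on differentiable_imp_continuous_within)

lemma Ck_Suc_imp: "Ck (Suc k) f \<Longrightarrow> Ck k f"
proof (induction k arbitrary: f)
  case 0 then have "Ck (Suc 0) f" .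
  from Ck_continuous[OF this] show ?case by simp
next
  case (Suc k) then show ?case by (metis Ck.simps(2))
qed

lemma Ck_const: "Ck k (\<lambda>z. c)"
  by (induction k arbitrary: c) auto

lemma Ck_bounded_linear:
  assumes "bounded_linear f"
  shows "Ck k f"
proof -
  have "dx f = (\<lambda>z. f 1)" "dy f = (\<lambda>z. f \<i>)"
    using bounded_linear_imp_has_derivative[OF assms] by (auto simp: dx_eq dy_eq)
  then show ?thesis
    using assms by (cases k) (auto intro: Ck_const linear_continuous_on bounded_linear_imp_differentiable)
qed

lemma Ck_add: "Ck k f \<Longrightarrow> Ck k g \<Longrightarrow> Ck k (\<lambda>z. f z + g z)"
proof (induction k arbitrary: f g)
  case 0 then show ?case by (auto intro: continuous_intros)
next
  case (Suc k)
  then have d: "\<And>z. f differentiable (at z)" "\<And>z. g differentiable (at z)" by auto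
  then have "dx (\<lambda>z. f z + g z) = (\<lambda>z. dx f z + dx g z)" "dy (\<lambda>z. f z + g z) = (\<lambda>z. dy f z + dy g z)"
    by (auto simp: dx_dy_add)
  with Suc d show ?case by auto
qed

lemma Ck_mult: "Ck k f \<Longrightarrow> Ck k g \<Longrightarrow> Ck k (\<lambda>z. f z * g z)"
proof (induction k arbitrary: f g)
  case 0 then show ?case by (auto intro: continuous_intros)
next
  case (Suc k)
  then have d: "\<And>z. f differentiable (at z)" "\<And>z. g differentiable (at z)" by auto
  then have e: "dx (\<lambda>z. f z * g z) = (\<lambda>z. dx f z * g z + f z * dx g z)"
    "dy (\<lambda>z. f z * g z) = (\<lambda>z. dy f z * g z + f z * dy g z)"
    by (auto simp: dx_dy_mult)
  \<comment> \<open>The product rule leaves one factor undifferentiated in each summand, so the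
    induction hypothesis also needs the factors themselves at level \<open>k\<close>.\<close>
  have "Ck k f" "Ck k g" using Suc.prems by (auto intro: Ck_Suc_imp simp del: Ck.simps)
  then show ?case using Suc d by (auto simp: e intro!: Ck_add)
qed

section \<open>Supports and the algebra of test functions\<close>

lemma dx_dy_zero_outside_support:
  assumes "z \<notin> fun_support f"
  shows "dx f z = 0" "dy f z = 0"
proof -
  have "open (- fun_support f)" by (simp add: fun_support_def open_Compl)
  moreover have "f w = 0" if "w \<in> - fun_support f" for w
    using that closure_subset[of "{z. f z \<noteq> 0}"] by (auto simp: fun_support_def)
  ultimately have "(f has_derivative (\<lambda>v. 0)) (at z)"
    using assms by (intro has_derivative_transform_within_open[OF has_derivative_const[of 0]]) auto
  then show "dx f z = 0" "dy f z = 0" by (simp_all add: dx_eq dy_eq)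
qed

lemma zero_outside_support: "z \<notin> fun_support f \<Longrightarrow> f z = 0"
  using closure_subset[of "{z. f z \<noteq> 0}"] by (auto simp: fun_support_def)

lemma fun_support_minimal: "closed S \<Longrightarrow> (\<And>z. z \<notin> S \<Longrightarrow> f z = 0) \<Longrightarrow> fun_support f \<subseteq> S"
  unfolding fun_support_def by (rule closure_minimal) auto

lemma closed_fun_support: "closed (fun_support f)"
  by (simp add: fun_support_def)

lemma test_functionsI:
  assumes "\<And>k. Ck k f" "compact S" "\<And>z. z \<notin> S \<Longrightarrow> f z = 0"
  shows "f \<in> test_functions"
proof -
  have "fun_support f \<subseteq> S"
    using assms by (intro fun_support_minimal compact_imp_closed)
  then have "compact (fun_support f)"
    using compact_Int_closed[OF assms(2) closed_fun_support[of f]] by (simp add: Int_absorb1)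
  with assms show ?thesis by (simp add: test_functions_def)
qed

lemma test_functionsD:
  assumes "\<phi> \<in> test_functions"
  shows "Ck k \<phi>" "compact (fun_support \<phi>)" "\<phi> differentiable (at z)" "continuous_on UNIV \<phi>"
    "Ck k (dx \<phi>)" "Ck k (dy \<phi>)"
proof -
  have *: "\<And>k. Ck k \<phi>" using assms by (simp add: test_functions_def)
  show "Ck k \<phi>" "compact (fun_support \<phi>)"
    using assms * by (auto simp: test_functions_def)
  show "continuous_on UNIV \<phi>" using *[of 0] by simp
  show "\<phi> differentiable (at z)" "Ck k (dx \<phi>)" "Ck k (dy \<phi>)" using *[of "Suc k"] by auto
qed

lemma test_function_mult:
  assumes "\<phi> \<in> test_functions" "\<And>k. Ck k f"
  shows "(\<lambda>z. f z * \<phi> z) \<in> test_functions"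
  using assms by (intro test_functionsI[of _ "fun_support \<phi>"])
    (auto intro: Ck_mult test_functionsD simp: zero_outside_support)

lemma test_function_add:
  assumes "\<phi> \<in> test_functions" "\<psi> \<in> test_functions"
  shows "(\<lambda>z. \<phi> z + \<psi> z) \<in> test_functions"
  using assms by (intro test_functionsI[of _ "fun_support \<phi> \<union> fun_support \<psi>"])
    (auto intro: Ck_add test_functionsD simp: zero_outside_support)

lemma test_function_dx_dy:
  assumes "\<phi> \<in> test_functions"
  shows "dx \<phi> \<in> test_functions" "dy \<phi> \<in> test_functions"
  using assms by (auto intro!: test_functionsI[of _ "fun_support \<phi>"]
      intro: test_functionsD simp: dx_dy_zero_outside_support)

lemma dbar_eq: "dbar f = (\<lambda>z. (1 / 2) * dx f z + (\<i> / 2) * dy f z)"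
  by (auto simp: dbar_def field_simps)

lemma test_function_dbar: "\<phi> \<in> test_functions \<Longrightarrow> dbar \<phi> \<in> test_functions"
  unfolding dbar_eq by (intro test_function_add test_function_mult test_function_dx_dy Ck_const)

text \<open>The derivatives of members of this family are combinations of members, so smoothness of
  compositions follows by an induction over all \<open>n\<close> at once.\<close>

definition exp_recip :: "nat \<Rightarrow> real \<Rightarrow> real"
  where "exp_recip n t = (if t > 0 then exp (- (1 / t)) / t ^ n else 0)"

text \<open>The single term of index \<open>n + 2\<close> in the series of
  \<open>exp (1 / t)\<close> gives \<open>exp (- (1 / t)) \<le> fact (n + 2) * t ^ (n + 2)\<close>.
  This index leaves \<open>t ^ 2\<close> after division by \<open>t ^ n\<close>, enough for a zero
  derivative at \<open>0\<close>.\<close>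

lemma exp_recip_bound:
  assumes "t > 0"
  shows "exp_recip n t \<le> fact (n + 2) * t ^ 2"
proof -
  have "(\<Sum>k\<in>{n+2}. (1/t) ^ k /\<^sub>R fact k) \<le> (\<Sum>k. (1/t) ^ k /\<^sub>R fact k)"
    using assms by (intro sum_le_suminf summable_exp_generic) auto
  then have "(1/t) ^ (n + 2) / fact (n + 2) \<le> exp (1/t)"
    by (simp only: exp_def sum.insert sum.empty finite.emptyI empty_iff not_False_eq_True
        add_0_right real_scaleR_def divide_inverse mult.commute)
  then have "1 / (fact (n + 2) * t ^ (n + 2)) \<le> exp (1/t)"
    by (simp add: power_one_over mult.commute del: power_Suc fact_Suc add_2_eq_Suc')
  then have "1 \<le> exp (1/t) * (fact (n + 2) * t ^ (n + 2))"
    using assms by (subst (asm) pos_divide_le_eq) auto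
  then have "exp (- (1/t)) \<le> fact (n + 2) * t ^ (n + 2)"
    using assms by (simp add: exp_minus field_simps)
  then show ?thesis
    using assms by (simp add: exp_recip_def field_simps power_add power2_eq_square)
qed

lemma exp_recip_nonneg: "0 \<le> exp_recip n t"
  by (simp add: exp_recip_def)

lemma exp_recip_deriv:
  "(exp_recip n has_real_derivative (exp_recip (n + 2) t - n * exp_recip (n + 1) t)) (at t)"
proof -
  consider "t > 0" | "t < 0" | "t = 0" by linarith
  then show ?thesis
  proof cases
    case 1
    have "((\<lambda>t. exp (- (1 / t)) / t ^ n) has_real_derivative
        (exp_recip (n + 2) t - n * exp_recip (n + 1) t)) (at t)"
    proof (cases n)
      case 0
      then show ?thesis
        using 1 by (auto intro!: derivative_eq_intros simp: exp_recip_def field_simps power2_eq_square)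
    next
      case (Suc m)
      have "((\<lambda>t. t ^ Suc m) has_real_derivative real (Suc m) * t ^ m) (at t)"
        using DERIV_pow[of "Suc m" t] by simp
      moreover have "((\<lambda>t. exp (- (1 / t))) has_real_derivative exp (- (1 / t)) / t ^ 2) (at t)"
        using 1 by (auto intro!: derivative_eq_intros simp: power2_eq_square)
      ultimately show ?thesis
        unfolding Suc using 1
        by (rule_tac DERIV_cong[OF DERIV_divide])
          (auto simp: exp_recip_def field_simps power2_eq_square)
    qed
    then show ?thesis
      by (rule has_field_derivative_transform_within_open[of _ _ _ "{0<..}"])
        (use 1 in \<open>auto simp: exp_recip_def\<close>)
  next
    case 2
    have "((\<lambda>t. 0) has_real_derivative 0) (at t)" by simp
    then have "(exp_recip n has_real_derivative 0) (at t)"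
      by (rule has_field_derivative_transform_within_open[of _ _ _ "{..<0}"])
        (use 2 in \<open>auto simp: exp_recip_def\<close>)
    then show ?thesis using 2 by (simp add: exp_recip_def)
  next
    case 3
    \<comment> \<open>All members of the family vanish at \<open>0\<close>, so this is the
      difference quotient there, squeezed by the quadratic bound.\<close>
    have "((\<lambda>h. exp_recip n h / h) \<longlongrightarrow> 0) (at 0)"
    proof (rule Lim_null_comparison)
      show "\<forall>\<^sub>F h in at 0. norm (exp_recip n h / h) \<le> fact (n + 2) * \<bar>h\<bar>"
      proof (intro always_eventually allI)
        fix h :: real
        show "norm (exp_recip n h / h) \<le> fact (n + 2) * \<bar>h\<bar>"
        proof (cases "h > 0")
          case True
          with exp_recip_bound[OF this, of n] exp_recip_nonneg[of n h] show ?thesis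
            by (simp add: power2_eq_square divide_le_eq mult.assoc)
        qed (simp add: exp_recip_def mult_nonneg_nonpos del: fact_Suc)
      qed
      have "((\<lambda>h::real. fact (n + 2) * \<bar>h\<bar>) \<longlongrightarrow> fact (n + 2) * \<bar>0\<bar>) (at 0)"
        by (intro tendsto_intros)
      then show "((\<lambda>h::real. fact (n + 2) * \<bar>h\<bar>) \<longlongrightarrow> 0) (at 0)" by simp
    qed
    then show ?thesis using 3 by (simp add: DERIV_def exp_recip_def)
  qed
qed

text \<open>\<open>u\<close> enters through its embedding into \<complex>, the setting of
  \<open>dx\<close> and \<open>dy\<close>. The imaginary part of the embedding is constantly
  \<open>0\<close>, so both partial derivatives are real and the real chain rule for
  \<open>h\<close> carries over.\<close>

lemma dx_dy_compose_real:
  assumes "(h has_real_derivative h') (at (u z))"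
    and "(\<lambda>z. complex_of_real (u z)) differentiable (at z)"
  shows "(\<lambda>z. complex_of_real (h (u z))) differentiable (at z)"
    and "dx (\<lambda>z. of_real (h (u z))) z = of_real h' * dx (\<lambda>z. of_real (u z)) z"
    and "dy (\<lambda>z. of_real (h (u z))) z = of_real h' * dy (\<lambda>z. of_real (u z)) z"
proof -
  let ?U = "\<lambda>z. complex_of_real (u z)"
  define D where "D = (\<lambda>v. Re v *\<^sub>R dx ?U z + Im v *\<^sub>R dy ?U z)"
  have D: "(?U has_derivative D) (at z)"
    unfolding D_def by (rule has_derivative_dx_dy[OF assms(2)])
  have "((\<lambda>z. Re (?U z)) has_derivative (\<lambda>v. Re (D v))) (at z)"
    by (rule bounded_linear.has_derivative[OF bounded_linear_Re D])
  moreover have "((\<lambda>z. Im (?U z)) has_derivative (\<lambda>v. Im (D v))) (at z)"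
    by (rule bounded_linear.has_derivative[OF bounded_linear_Im D])
  ultimately have u: "(u has_derivative (\<lambda>v. Re (D v))) (at z)"
    and "((\<lambda>z. 0 :: real) has_derivative (\<lambda>v. Im (D v))) (at z)" by simp_all
  from has_derivative_unique[OF this(2) has_derivative_const] have im: "Im (D v) = 0" for v
    by meson
  have "((\<lambda>z. h (u z)) has_derivative (\<lambda>v. h' * Re (D v))) (at z)"
    using diff_chain_at[OF u, of h "(*) h'"] assms(1) by (simp add: has_field_derivative_def o_def)
  then have *: "((\<lambda>z. complex_of_real (h (u z))) has_derivative (\<lambda>v. of_real (h' * Re (D v)))) (at z)"
    by (rule has_derivative_of_real)
  then show "(\<lambda>z. complex_of_real (h (u z))) differentiable (at z)"
    by (auto simp: differentiable_def)
  show "dx (\<lambda>z. of_real (h (u z))) z = of_real h' * dx ?U z"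
    using im[of 1] by (simp add: dx_eq[OF *] D_def complex_eq_iff)
  show "dy (\<lambda>z. of_real (h (u z))) z = of_real h' * dy ?U z"
    using im[of \<i>] by (simp add: dy_eq[OF *] D_def complex_eq_iff)
qed

lemma Ck_exp_recip:
  assumes "\<And>k. Ck k (\<lambda>z. of_real (u z))"
  shows "Ck k (\<lambda>z. of_real (exp_recip n (u z)))"
proof (induction k arbitrary: n)
  case 0
  have "continuous_on UNIV (\<lambda>z. Re (of_real (u z)))"
    by (intro continuous_on_Re Ck_continuous[OF assms])
  then have "continuous_on UNIV u" by simp
  moreover have "continuous_on UNIV (exp_recip n)"
    by (rule continuous_at_imp_continuous_on) (blast intro: DERIV_isCont exp_recip_deriv)
  ultimately show ?case
    by (auto intro!: continuous_intros intro: continuous_on_compose2)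
next
  case (Suc k)
  have "\<And>z. (\<lambda>z. complex_of_real (u z)) differentiable (at z)"
    using assms[of "Suc 0"] by simp
  note * = dx_dy_compose_real[OF exp_recip_deriv this]
  have "Ck k (\<lambda>z. of_real (exp_recip (n + 2) (u z)) + (- of_nat n) * of_real (exp_recip (n + 1) (u z)))"
    by (intro Ck_add Ck_mult Ck_const Suc.IH)
  then have C: "Ck k (\<lambda>z. of_real (exp_recip (n + 2) (u z) - n * exp_recip (n + 1) (u z)))"
    by simp
  have "Ck k (dx (\<lambda>z. of_real (u z)))" "Ck k (dy (\<lambda>z. of_real (u z)))"
    using assms[of "Suc k"] by simp_all
  from this[THEN Ck_mult[OF C]] show ?case
    unfolding Ck.simps using *[of n] by presburger
qed

section \<open>Radial cutoff functions\<close>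

text \<open>A smooth step from \<open>1\<close> to \<open>0\<close>: the argument of the outer
  \<open>exp_recip 0\<close> is \<open>1\<close> for \<open>s \<le> a\<close> and, by monotonicity,
  at most \<open>0\<close> for \<open>s \<ge> b\<close> if \<open>a < b\<close>. The factor
  \<open>exp 1\<close> cancels \<open>exp_recip 0 1\<close>. The inner denominator is constant, so
  smoothness comes from \<open>Ck_exp_recip\<close>, sums and products.\<close>

definition bump :: "real \<Rightarrow> real \<Rightarrow> real \<Rightarrow> real"
  where "bump a b s = exp 1 * exp_recip 0 (1 - exp_recip 0 (s - a) / exp_recip 0 (b - a))"

text \<open>\<open>exp_recip 2\<close> appears as the derivative of \<open>exp_recip 0\<close>. The
  closed form makes smoothness and the vanishing on either side of the step visible.\<close>

definition bump_deriv :: "real \<Rightarrow> real \<Rightarrow> real \<Rightarrow> real"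
  where "bump_deriv a b s = - (exp 1 / exp_recip 0 (b - a) *
    (exp_recip 2 (1 - exp_recip 0 (s - a) / exp_recip 0 (b - a)) * exp_recip 2 (s - a)))"

lemma bump_eq_1: "s \<le> a \<Longrightarrow> bump a b s = 1"
  by (simp add: bump_def exp_recip_def exp_minus)

lemma exp_recip_0_mono:
  assumes "0 < s" "s \<le> t"
  shows "exp_recip 0 s \<le> exp_recip 0 t"
  using assms by (simp add: exp_recip_def frac_le)

lemma bump_eq_0:
  assumes "a < b" "b \<le> s"
  shows "bump a b s = 0" "bump_deriv a b s = 0"
proof -
  have "exp_recip 0 (b - a) \<le> exp_recip 0 (s - a)" "0 < exp_recip 0 (b - a)"
    using assms exp_recip_0_mono by (auto simp: exp_recip_def)
  then have "1 - exp_recip 0 (s - a) / exp_recip 0 (b - a) \<le> 0"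
    by (simp add: le_divide_eq)
  then show "bump a b s = 0" "bump_deriv a b s = 0"
    unfolding bump_def bump_deriv_def by (simp_all add: exp_recip_def)
qed

lemma bump_deriv_eq_0: "s \<le> a \<Longrightarrow> bump_deriv a b s = 0"
  by (simp add: bump_deriv_def exp_recip_def)

lemma bump_has_deriv: "(bump a b has_real_derivative bump_deriv a b s) (at s)"
proof -
  let ?K = "exp_recip 0 (b - a)"
  have "((\<lambda>s. s - a) has_real_derivative 1) (at s)"
    by (auto intro!: derivative_eq_intros)
  from DERIV_chain2[OF exp_recip_deriv[of 0] this]
  have 1: "((\<lambda>s. exp_recip 0 (s - a)) has_real_derivative exp_recip 2 (s - a)) (at s)"
    by (simp flip: numeral_2_eq_2)
  have 2: "((\<lambda>s. 1 - exp_recip 0 (s - a) / ?K) has_real_derivative (0 - exp_recip 2 (s - a) / ?K)) (at s)"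
    by (intro DERIV_diff DERIV_const DERIV_cdivide 1)
  from DERIV_cmult[OF DERIV_chain2[OF exp_recip_deriv[of 0] 2], of "exp 1"] show ?thesis
    by (simp add: bump_def[abs_def] bump_deriv_def flip: numeral_2_eq_2)
qed

lemma Ck_bump:
  assumes "\<And>k. Ck k (\<lambda>z. of_real (u z))"
  shows "Ck k (\<lambda>z. of_real (bump a b (u z)))" "Ck k (\<lambda>z. of_real (bump_deriv a b (u z)))"
proof -
  have "Ck k (\<lambda>z. of_real (u z) + of_real (- a))" for k
    by (intro Ck_add Ck_const assms)
  then have 1: "Ck k (\<lambda>z. of_real (exp_recip n (u z - a)))" for k n
    by (intro Ck_exp_recip) simp
  have "Ck k (\<lambda>z. 1 + of_real (- (1 / exp_recip 0 (b - a))) * of_real (exp_recip 0 (u z - a)))" for k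
    by (intro Ck_add Ck_mult Ck_const 1)
  then have 2: "Ck k (\<lambda>z. of_real (exp_recip n (1 - exp_recip 0 (u z - a) / exp_recip 0 (b - a))))" for k n
    by (intro Ck_exp_recip) simp
  have "Ck k (\<lambda>z. of_real (exp 1) * of_real (exp_recip 0 (1 - exp_recip 0 (u z - a) / exp_recip 0 (b - a))))"
    by (intro Ck_mult Ck_const 2)
  then show "Ck k (\<lambda>z. of_real (bump a b (u z)))" by (simp add: bump_def)
  have "Ck k (\<lambda>z. of_real (- (exp 1 / exp_recip 0 (b - a))) *
      (of_real (exp_recip 2 (1 - exp_recip 0 (u z - a) / exp_recip 0 (b - a))) * of_real (exp_recip 2 (u z - a))))"
    by (intro Ck_mult Ck_const 1 2)
  then show "Ck k (\<lambda>z. of_real (bump_deriv a b (u z)))" by (simp add: bump_deriv_def)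
qed

text \<open>The squared distance is a product of an affine map and its conjugate, hence smooth even
  at \<open>c\<close>, where the distance itself is not. Cutoff functions therefore use the
  square.\<close>

lemma Ck_dist_power2: "Ck k (\<lambda>z. of_real ((norm (z - c))\<^sup>2))"
proof -
  have "Ck k (\<lambda>z. (z + (- c)) * (cnj z + (- cnj c)))"
    by (intro Ck_mult Ck_add Ck_const Ck_bounded_linear bounded_linear_ident bounded_linear_cnj)
  then show ?thesis by (simp add: complex_norm_square[of "_ - _"] del: of_real_power)
qed

lemma test_function_bump:
  assumes "a < b"
  shows "(\<lambda>z. of_real (bump a b ((norm (z - c))\<^sup>2))) \<in> test_functions"
    and "(\<lambda>z. of_real (bump_deriv a b ((norm (z - c))\<^sup>2))) \<in> test_functions"
proof -
  have "b \<le> (norm (z - c))\<^sup>2" if "z \<notin> cball c (sqrt b)" for z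
  proof -
    from that have "sqrt b < norm (z - c)" by (simp add: dist_norm norm_minus_commute)
    then show ?thesis using real_le_lsqrt sqrt_le_D by fastforce
  qed
  then show "(\<lambda>z. of_real (bump a b ((norm (z - c))\<^sup>2))) \<in> test_functions"
    "(\<lambda>z. of_real (bump_deriv a b ((norm (z - c))\<^sup>2))) \<in> test_functions"
    using assms by (auto intro!: test_functionsI[of _ "cball c (sqrt b)"] Ck_bump Ck_dist_power2
        simp: bump_eq_0)
qed

section \<open>Localization\<close>

text \<open>The complement of \<open>dist_support\<close> is a union of open null sets, and a
  function supported in the union need not be supported in a single one. By compactness finitely
  many balls suffice, and cutoff functions split \<open>\<phi>\<close> into pieces that
  \<open>T\<close> kills.\<close>

lemma distribution_zero_off_support:
  fixes T :: "(complex \<Rightarrow> complex) \<Rightarrow> 'v::complex_normed_vector \<Rightarrow>\<^sub>L 'v"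
  assumes add: "\<And>\<phi> \<psi>. \<phi> \<in> test_functions \<Longrightarrow> \<psi> \<in> test_functions \<Longrightarrow> T (\<lambda>z. \<phi> z + \<psi> z) = T \<phi> + T \<psi>"
    and \<phi>: "\<phi> \<in> test_functions" and disj: "fun_support \<phi> \<inter> dist_support T = {}"
  shows "T \<phi> = 0"
proof -
  have "\<forall>c\<in>fun_support \<phi>. \<exists>r. r > 0 \<and> (\<forall>\<psi>\<in>test_functions. fun_support \<psi> \<subseteq> cball c r \<longrightarrow> T \<psi> = 0)"
  proof
    fix c assume c: "c \<in> fun_support \<phi>"
    obtain U where "open U" "c \<in> U" and U: "\<forall>\<psi>\<in>test_functions. fun_support \<psi> \<subseteq> U \<longrightarrow> T \<psi> = 0"
      using disj c unfolding dist_support_def by blast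
    obtain r where "r > 0" "cball c r \<subseteq> U"
      using open_contains_cball \<open>open U\<close> \<open>c \<in> U\<close> by blast
    with U show "\<exists>r. r > 0 \<and> (\<forall>\<psi>\<in>test_functions. fun_support \<psi> \<subseteq> cball c r \<longrightarrow> T \<psi> = 0)"
      by (intro exI[of _ r]) blast
  qed
  from bchoice[OF this] obtain r where r: "\<And>c. c \<in> fun_support \<phi> \<Longrightarrow> r c > 0"
    and T0: "\<And>c \<psi>. c \<in> fun_support \<phi> \<Longrightarrow> \<psi> \<in> test_functions \<Longrightarrow> fun_support \<psi> \<subseteq> cball c (r c)
      \<Longrightarrow> T \<psi> = 0"
    by blast
  \<comment> \<open>The cover uses balls of half the radius, so that a cutoff function equal to
    \<open>1\<close> on the half ball still fits into the full ball, where \<open>T\<close>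
    vanishes.\<close>
  have fin: "T \<psi> = 0" if "finite F" "F \<subseteq> fun_support \<phi>" "\<psi> \<in> test_functions"
    "fun_support \<psi> \<subseteq> (\<Union>c\<in>F. ball c (r c / 2))" for F \<psi>
    using that
  proof (induction F arbitrary: \<psi> rule: finite_induct)
    case empty
    then have "\<psi> = (\<lambda>z. 0)" using zero_outside_support by blast
    \<comment> \<open>The zero function is its own double, so additivity forces its value to be
      \<open>0\<close>.\<close>
    with add[OF empty.prems(2,2)] show ?case by simp
  next
    case (insert c F)
    have c: "r c > 0" using r insert.prems by auto
    \<comment> \<open>\<open>\<kappa> * \<psi>\<close> is supported in the full ball at
      \<open>c\<close> and handled by \<open>T0\<close>; \<open>(1 - \<kappa>) * \<psi>\<close>
      vanishes on the half ball, so the balls of \<open>F\<close> cover its support.\<close>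
    define \<kappa> where "\<kappa> z = complex_of_real (bump ((r c / 2)\<^sup>2) ((r c)\<^sup>2) ((norm (z - c))\<^sup>2))" for z
    have \<kappa>: "Ck k \<kappa>" for k
      unfolding \<kappa>_def by (intro Ck_bump Ck_dist_power2)
    have "Ck k (\<lambda>z. 1 + (- 1) * \<kappa> z)" for k
      by (intro Ck_add Ck_mult Ck_const \<kappa>)
    from test_function_mult[OF insert.prems(2) this] test_function_mult[OF insert.prems(2) \<kappa>]
    have t: "(\<lambda>z. \<kappa> z * \<psi> z) \<in> test_functions" "(\<lambda>z. (1 - \<kappa> z) * \<psi> z) \<in> test_functions"
      by simp_all
    have lt: "(r c / 2)\<^sup>2 < (r c)\<^sup>2"
      using c by (intro power_strict_mono) auto
    have "\<kappa> z = 0" if "z \<notin> cball c (r c)" for z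
    proof -
      have "(r c)\<^sup>2 \<le> (norm (z - c))\<^sup>2"
        using that c by (intro power_mono) (auto simp: dist_norm norm_minus_commute)
      then show ?thesis using bump_eq_0(1)[OF lt] by (simp add: \<kappa>_def)
    qed
    then have "fun_support (\<lambda>z. \<kappa> z * \<psi> z) \<subseteq> cball c (r c)"
      by (intro fun_support_minimal) auto
    then have T1: "T (\<lambda>z. \<kappa> z * \<psi> z) = 0"
      using insert.prems(1) by (intro T0[of c] t(1)) auto
    have "\<kappa> z = 1" if "z \<in> ball c (r c / 2)" for z
    proof -
      have "(norm (z - c))\<^sup>2 \<le> (r c / 2)\<^sup>2"
        using that by (intro power_mono) (auto simp: dist_norm norm_minus_commute)
      then show ?thesis using bump_eq_1 by (simp add: \<kappa>_def)
    qed
    then have "fun_support (\<lambda>z. (1 - \<kappa> z) * \<psi> z) \<subseteq> fun_support \<psi> - ball c (r c / 2)"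
      by (intro fun_support_minimal) (auto simp: zero_outside_support closed_fun_support closed_Diff)
    also have "\<dots> \<subseteq> (\<Union>c\<in>F. ball c (r c / 2))"
      using insert.prems(3) by blast
    finally have "T (\<lambda>z. (1 - \<kappa> z) * \<psi> z) = 0"
      using insert.prems(1) by (intro insert.IH t(2)) auto
    with T1 add[OF t] show ?case by (simp add: algebra_simps)
  qed
  have "fun_support \<phi> \<subseteq> (\<Union>c\<in>fun_support \<phi>. ball c (r c / 2))"
    using r by (auto intro!: bexI)
  from compactE_image[OF test_functionsD(2)[OF \<phi>] open_ball this] obtain F
    where "F \<subseteq> fun_support \<phi>" "finite F" "fun_support \<phi> \<subseteq> (\<Union>c\<in>F. ball c (r c / 2))"
    by blast
  with fin \<phi> show ?thesis by blast
qed

section \<open>Integration of test functions\<close>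

lemma integrable_test_function:
  assumes "\<phi> \<in> test_functions"
  shows "integrable lborel \<phi>"
proof -
  have "integrable lborel (\<lambda>z. indicator (fun_support \<phi>) z *\<^sub>R \<phi> z)"
    using test_functionsD(2,4)[OF assms]
    by (intro borel_integrable_compact) (auto intro: continuous_on_subset)
  also have "(\<lambda>z. indicator (fun_support \<phi>) z *\<^sub>R \<phi> z) = \<phi>"
    by (auto simp: indicator_def zero_outside_support)
  finally show ?thesis .
qed

lemma test_function_bounded:
  assumes "\<phi> \<in> test_functions"
  obtains B where "B > 0" "\<And>z. norm (\<phi> z) \<le> B"
proof -
  have "compact (\<phi> ` fun_support \<phi>)"
    using test_functionsD(2,4)[OF assms] by (auto intro: compact_continuous_image continuous_on_subset)
  then obtain B where "B > 0" and B: "\<And>z. z \<in> fun_support \<phi> \<Longrightarrow> norm (\<phi> z) \<le> B"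
    using compact_imp_bounded bounded_pos by (metis imageI)
  moreover have "norm (\<phi> z) \<le> B" for z
    using B[of z] zero_outside_support[of z \<phi>] \<open>B > 0\<close> by (cases "z \<in> fun_support \<phi>") auto
  ultimately show ?thesis using that by blast
qed

text \<open>Supplies the uniform bound on difference quotients for dominated convergence.\<close>

lemma test_function_lipschitz:
  assumes "\<phi> \<in> test_functions"
  obtains B where "B > 0" "\<And>z w. norm (\<phi> z - \<phi> w) \<le> B * norm (z - w)"
proof -
  obtain B1 B2 where B: "B1 > 0" "B2 > 0" "\<And>z. norm (dx \<phi> z) \<le> B1" "\<And>z. norm (dy \<phi> z) \<le> B2"
    using test_function_bounded test_function_dx_dy[OF assms] by metis
  have "norm (\<phi> z - \<phi> w) \<le> (B1 + B2) * norm (z - w)" for z w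
  proof (rule differentiable_bound[of UNIV])
    show "(\<phi> has_derivative (\<lambda>v. Re v *\<^sub>R dx \<phi> x + Im v *\<^sub>R dy \<phi> x)) (at x within UNIV)" for x
      using has_derivative_dx_dy[OF test_functionsD(3)[OF assms]] by simp
    show "onorm (\<lambda>v. Re v *\<^sub>R dx \<phi> x + Im v *\<^sub>R dy \<phi> x) \<le> B1 + B2" for x
    proof (rule onorm_bound)
      fix v
      have "norm (Re v *\<^sub>R dx \<phi> x + Im v *\<^sub>R dy \<phi> x) \<le> \<bar>Re v\<bar> * norm (dx \<phi> x) + \<bar>Im v\<bar> * norm (dy \<phi> x)"
        by (metis norm_scaleR norm_triangle_ineq)
      also have "\<dots> \<le> norm v * B1 + norm v * B2"
        using B abs_Re_le_cmod abs_Im_le_cmod by (intro add_mono mult_mono) auto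
      finally show "norm (Re v *\<^sub>R dx \<phi> x + Im v *\<^sub>R dy \<phi> x) \<le> (B1 + B2) * norm v"
        by (simp add: algebra_simps)
    qed (use B in auto)
  qed auto
  then show ?thesis using that[of "B1 + B2"] B by auto
qed

text \<open>Difference quotients have integral \<open>0\<close> by translation invariance of
  Lebesgue measure, and dominated convergence passes this on to the derivative.\<close>

lemma integral_directional_derivative:
  assumes \<phi>: "\<phi> \<in> test_functions" and v: "norm v = 1"
  shows "(LINT z|lborel. Re v *\<^sub>R dx \<phi> z + Im v *\<^sub>R dy \<phi> z) = 0"
proof -
  define t where "t n = inverse (real (Suc n))" for n
  have t: "0 < t n" "t n \<le> 1" for n by (auto simp: t_def field_simps)
  define s where "s n z = (\<phi> (z + t n *\<^sub>R v) - \<phi> z) /\<^sub>R t n" for n z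
  note int = integrable_test_function[OF \<phi>]
  have int': "integrable lborel (\<lambda>z. \<phi> (z + c))" "(LINT z|lborel. \<phi> (z + c)) = (LINT z|lborel. \<phi> z)" for c
  proof -
    have m: "(+) c \<in> measurable lborel borel" "\<phi> \<in> borel_measurable borel"
      using int by auto
    have "integrable (distr lborel borel ((+) c)) \<phi>" using int by (simp add: lborel_distr_plus)
    then show "integrable lborel (\<lambda>z. \<phi> (z + c))"
      using integrable_distr_eq[OF m] by (simp add: add.commute)
    show "(LINT z|lborel. \<phi> (z + c)) = (LINT z|lborel. \<phi> z)"
      using integral_distr[OF m] by (simp add: lborel_distr_plus add.commute)
  qed
  have s0: "(LINT z|lborel. s n z) = 0" for n
    unfolding s_def using int int'[of "t n *\<^sub>R v"] by simp
  obtain B where "B > 0" and B: "\<And>z w. norm (\<phi> z - \<phi> w) \<le> B * norm (z - w)"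
    by (rule test_function_lipschitz[OF \<phi>]) (rule that)
  obtain \<rho> where \<rho>: "\<And>z. z \<in> fun_support \<phi> \<Longrightarrow> norm z \<le> \<rho>"
    using compact_imp_bounded[OF test_functionsD(2)[OF \<phi>]] unfolding bounded_iff by auto
  have "(\<lambda>n. LINT z|lborel. s n z) \<longlonglongrightarrow> (LINT z|lborel. Re v *\<^sub>R dx \<phi> z + Im v *\<^sub>R dy \<phi> z)"
  proof (rule integral_dominated_convergence)
    show "(\<lambda>z. Re v *\<^sub>R dx \<phi> z + Im v *\<^sub>R dy \<phi> z) \<in> borel_measurable lborel"
      using test_function_dx_dy[OF \<phi>, THEN integrable_test_function]
      by (intro borel_measurable_add borel_measurable_scaleR borel_measurable_const) auto
    show "s n \<in> borel_measurable lborel" for n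
      unfolding s_def using int int'(1)[of "t n *\<^sub>R v"] by (intro borel_measurable_scaleR borel_measurable_diff) auto
    \<comment> \<open>The steps are at most \<open>1\<close>, so \<open>\<phi>\<close> and its
      translate vanish outside radius \<open>\<rho> + 1\<close>; inside, the Lipschitz constant
      bounds the quotient.\<close>
    show "integrable lborel (\<lambda>z::complex. indicator (cball 0 (\<rho> + 1)) z *\<^sub>R B)"
      by (intro borel_integrable_compact) auto
    show "AE z in lborel. norm (s n z) \<le> indicator (cball 0 (\<rho> + 1)) z *\<^sub>R B" for n
    proof (rule AE_I2)
      fix z
      show "norm (s n z) \<le> indicator (cball 0 (\<rho> + 1)) z *\<^sub>R B"
      proof (cases "norm z \<le> \<rho> + 1")
        case True
        have "norm (\<phi> (z + t n *\<^sub>R v) - \<phi> z) \<le> B * t n"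
          using B[of "z + t n *\<^sub>R v" z] t[of n] v by simp
        moreover have "norm (s n z) = norm (\<phi> (z + t n *\<^sub>R v) - \<phi> z) / t n"
          using t[of n] by (simp add: s_def divide_inverse mult.commute)
        ultimately show ?thesis using t[of n] True by (simp add: pos_divide_le_eq)
      next
        case False
        have "norm z \<le> norm (z + t n *\<^sub>R v) + norm (t n *\<^sub>R v)"
          using norm_triangle_ineq4[of "z + t n *\<^sub>R v" "t n *\<^sub>R v"] by simp
        then have "norm (z + t n *\<^sub>R v) > \<rho>" "norm z > \<rho>" using False t[of n] v by auto
        then have "\<phi> (z + t n *\<^sub>R v) = 0" "\<phi> z = 0"
          using \<rho>[of z] \<rho>[of "z + t n *\<^sub>R v"] zero_outside_support[of _ \<phi>] by (auto simp: not_le)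
        then show ?thesis using \<open>B > 0\<close> by (simp add: s_def)
      qed
    qed
    show "AE z in lborel. (\<lambda>n. s n z) \<longlonglongrightarrow> Re v *\<^sub>R dx \<phi> z + Im v *\<^sub>R dy \<phi> z"
    proof (rule AE_I2)
      fix z
      let ?D = "\<lambda>v. Re v *\<^sub>R dx \<phi> z + Im v *\<^sub>R dy \<phi> z"
      have "((\<lambda>h. norm (\<phi> (z + h) - \<phi> z - ?D h) / norm h) \<longlongrightarrow> 0) (at 0)"
        using has_derivative_dx_dy[OF test_functionsD(3)[OF \<phi>]] by (simp add: has_derivative_at)
      moreover have "filterlim (\<lambda>n. t n *\<^sub>R v) (at 0) sequentially"
        unfolding filterlim_at
      proof
        have "t \<longlonglongrightarrow> 0" unfolding t_def by (rule LIMSEQ_inverse_real_of_nat)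
        then show "(\<lambda>n. t n *\<^sub>R v) \<longlonglongrightarrow> 0" using tendsto_scaleR[OF _ tendsto_const[of v], of t 0 sequentially] by simp
        show "\<forall>\<^sub>F n in sequentially. t n *\<^sub>R v \<in> UNIV \<and> t n *\<^sub>R v \<noteq> 0"
        proof (intro always_eventually allI)
          fix n
          show "t n *\<^sub>R v \<in> UNIV \<and> t n *\<^sub>R v \<noteq> 0"
            using t(1)[of n] v by auto
        qed
      qed
      ultimately have "(\<lambda>n. norm (\<phi> (z + t n *\<^sub>R v) - \<phi> z - ?D (t n *\<^sub>R v)) / norm (t n *\<^sub>R v)) \<longlonglongrightarrow> 0"
        by (rule filterlim_compose)
      \<comment> \<open>Since \<open>norm v = 1\<close>, the remainder divided by the length of the
        step is the distance of the quotient from its limit.\<close>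
      moreover have "norm (\<phi> (z + t n *\<^sub>R v) - \<phi> z - ?D (t n *\<^sub>R v)) / norm (t n *\<^sub>R v) = norm (s n z - ?D v)" for n
      proof -
        have "s n z - ?D v = (\<phi> (z + t n *\<^sub>R v) - \<phi> z - ?D (t n *\<^sub>R v)) /\<^sub>R t n"
          using t[of n] by (simp add: s_def algebra_simps)
        then show ?thesis using t[of n] v by (simp add: divide_inverse mult.commute)
      qed
      ultimately have "(\<lambda>n. norm (s n z - ?D v)) \<longlonglongrightarrow> 0" by simp
      then show "(\<lambda>n. s n z) \<longlonglongrightarrow> ?D v"
        by (rule LIM_zero_cancel[OF tendsto_norm_zero_cancel])
    qed
  qed
  with s0 show ?thesis using LIMSEQ_unique[OF _ tendsto_const[of 0]] by simp
qed

lemma integral_dx_dy: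
  assumes "\<phi> \<in> test_functions"
  shows "(LINT z|lborel. dx \<phi> z) = 0" "(LINT z|lborel. dy \<phi> z) = 0"
  using integral_directional_derivative[OF assms, of 1] integral_directional_derivative[OF assms, of \<i>]
  by simp_all

lemma integral_dbar:
  assumes "\<phi> \<in> test_functions"
  shows "(LINT z|lborel. dbar \<phi> z) = 0"
  using integral_dx_dy[OF assms] integrable_test_function[OF test_function_dx_dy(1)[OF assms]]
    integrable_test_function[OF test_function_dx_dy(2)[OF assms]]
  by (simp add: dbar_eq)

text \<open>The sign is there because \<open>measure_eqI_lessThan\<close> compares measures on the upper
  half-lines, which must have finite measure.\<close>

lemma distr_norm_power2:
  "distr (lborel :: complex measure) borel (\<lambda>z. - (norm z)\<^sup>2)
    = density lborel (\<lambda>t. ennreal (pi * indicator {..<0} t))"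
proof (rule measure_eqI_lessThan)
  \<comment> \<open>The half-line pulls back to a disc of squared radius \<open>- x\<close>. Area is
    linear in the squared radius, whence the constant density \<open>pi\<close>.\<close>
  have *: "emeasure (distr (lborel :: complex measure) borel (\<lambda>z. - (norm z)\<^sup>2)) {x<..} = ennreal (pi * max 0 (- x))"
    for x
  proof -
    have "(\<lambda>z::complex. - (norm z)\<^sup>2) -` {x<..} = (if x < 0 then ball 0 (sqrt (- x)) else {})"
    proof -
      have "norm z < sqrt (- x) \<longleftrightarrow> x < - (norm z)\<^sup>2" for z :: complex
        using real_sqrt_less_iff[of "(norm z)\<^sup>2" "- x"] by auto
      moreover have "\<not> x < - (norm z)\<^sup>2" if "\<not> x < 0" for z :: complex
        using that zero_le_power2[of "norm z"] by linarith
      ultimately show ?thesis by auto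
    qed
    moreover have "emeasure lborel (ball (0::complex) (sqrt (- x))) = ennreal (pi * (- x))" if "x < 0"
      using that by (simp add: emeasure_ball unit_ball_vol_2)
    ultimately show ?thesis by (simp add: emeasure_distr max_def)
  qed
  show "emeasure (distr (lborel :: complex measure) borel (\<lambda>z. - (norm z)\<^sup>2)) {x<..} < \<infinity>" for x
    by (simp add: *)
  show "emeasure (distr (lborel :: complex measure) borel (\<lambda>z. - (norm z)\<^sup>2)) {x<..}
    = emeasure (density lborel (\<lambda>t. ennreal (pi * indicator {..<0} t))) {x<..}" for x
  proof -
    have "emeasure (density lborel (\<lambda>t. ennreal (pi * indicator {..<0} t))) {x<..}
        = (\<integral>\<^sup>+t. ennreal pi * indicator ({x<..<0}) t \<partial>lborel)"
      by (subst emeasure_density) (auto intro!: nn_integral_cong simp: indicator_def)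
    also have "\<dots> = ennreal pi * emeasure lborel {x<..<0}"
      by (rule nn_integral_cmult_indicator) simp
    also have "\<dots> = ennreal (pi * max 0 (- x))"
    proof (cases "x < 0")
      case True
      then show ?thesis by (simp flip: ennreal_mult)
    next
      case False
      then have "{x<..<0} = {}" by auto
      with False show ?thesis by simp
    qed
    finally show ?thesis using * by simp
  qed
qed auto

text \<open>In the variable \<open>|z|^2\<close> the area integral is \<open>pi\<close> times the
  integral of \<open>bump_deriv\<close> over the line, and \<open>bump\<close> falls from
  \<open>1\<close> to \<open>0\<close>.\<close>

lemma integral_bump_deriv:
  assumes "0 < a" "a < b"
  shows "(LINT z|lborel. bump_deriv a b ((norm (z::complex))\<^sup>2)) = - pi"
proof -
  let ?\<gamma> = "bump_deriv a b"
  have c: "continuous_on UNIV ?\<gamma>"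
  proof -
    have "continuous_on UNIV (exp_recip n)" for n
      by (rule continuous_at_imp_continuous_on) (blast intro: DERIV_isCont exp_recip_deriv)
    then have e: "continuous_on UNIV (\<lambda>s. exp_recip n (f s))" if "continuous_on UNIV f" for n and f :: "real \<Rightarrow> real"
      using that continuous_on_compose2 by blast
    have "exp_recip 0 (b - a) \<noteq> 0" using assms by (simp add: exp_recip_def)
    then show ?thesis unfolding bump_deriv_def[abs_def] by (intro continuous_intros e) auto
  qed
  then have m: "?\<gamma> \<in> borel_measurable borel" by (rule borel_measurable_continuous_onI)
  have "(LINT z|lborel. ?\<gamma> ((norm (z::complex))\<^sup>2)) = (LINT t|distr (lborel :: complex measure) borel (\<lambda>z. - (norm z)\<^sup>2). ?\<gamma> (- t))"
    using m by (subst integral_distr) auto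
  also have "\<dots> = (LINT t|lborel. (pi * indicator {..<0} t) *\<^sub>R ?\<gamma> (- t))"
    unfolding distr_norm_power2 using m by (subst integral_density) auto
  \<comment> \<open>\<open>bump_deriv\<close> vanishes off the step, so the half-line shrinks to an
    interval and the fundamental theorem of calculus applies, with antiderivative
    \<open>- bump a b (- t)\<close>.\<close>
  also have "\<dots> = (LINT t|lborel. pi * (indicator {-b .. -a} t *\<^sub>R ?\<gamma> (- t)))"
    using assms bump_eq_0(2)[of a b] bump_deriv_eq_0[of _ a b]
    by (intro Bochner_Integration.integral_cong) (auto simp: indicator_def)
  also have "\<dots> = pi * (LINT t|lborel. indicator {-b .. -a} t *\<^sub>R ?\<gamma> (- t))"
    by simp
  also have "(LINT t|lborel. indicator {-b .. -a} t *\<^sub>R ?\<gamma> (- t)) = - bump a b (- (- a)) - (- bump a b (- (- b)))"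
  proof (rule integral_FTC_atLeastAtMost)
    show "((\<lambda>t. - bump a b (- t)) has_vector_derivative ?\<gamma> (- x)) (at x within {- b..- a})" for x
    proof -
      have "((\<lambda>t. bump a b (- t)) has_real_derivative ?\<gamma> (- x) * (- 1)) (at x)"
        by (rule DERIV_chain2[OF bump_has_deriv]) (auto intro!: derivative_eq_intros)
      then have "((\<lambda>t. - bump a b (- t)) has_real_derivative ?\<gamma> (- x)) (at x)"
        using DERIV_minus by fastforce
      then show ?thesis
        using has_vector_derivative_at_within has_real_derivative_iff_has_vector_derivative by blast
    qed
    show "continuous_on {- b..- a} (\<lambda>x. ?\<gamma> (- x))"
      using c by (intro continuous_on_compose2[OF c]) (auto intro: continuous_intros)
  qed (use assms in auto)
  finally show ?thesis using assms by (simp add: bump_eq_1 bump_eq_0)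
qed

section \<open>The Neumann series\<close>

lemma bounded_linear_scaleC_left: "bounded_linear (\<lambda>c. c *\<^sub>C (x::'a::complex_normed_vector))"
proof (rule bounded_linear_intro)
  show "(r *\<^sub>R c) *\<^sub>C x = r *\<^sub>R (c *\<^sub>C x)" for r c
    by (simp add: scaleR_scaleC[where 'a='a] scaleC_scaleC scaleR_conv_of_real)
  show "norm (c *\<^sub>C x) \<le> norm c * norm x" for c
    by (simp add: norm_scaleC)
qed (rule scaleC_add_left)

lemmas scaleC_zero_left = linear_0[OF bounded_linear.linear[OF bounded_linear_scaleC_left]]
  and scaleC_zero_right = linear_0[OF bounded_linear.linear[OF bounded_linear_scaleC]]
  and scaleC_minus_left = linear_neg[OF bounded_linear.linear[OF bounded_linear_scaleC_left]]
  and scaleC_minus_right = linear_neg[OF bounded_linear.linear[OF bounded_linear_scaleC]]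
  and scaleC_diff_right = linear_diff[OF bounded_linear.linear[OF bounded_linear_scaleC]]
  and scaleC_sum_right = linear_sum[OF bounded_linear.linear[OF bounded_linear_scaleC]]

declare scaleC_one [simp] scaleC_zero_left [simp] scaleC_zero_right [simp]

lemma blinfun_compose_scaleC:
  "A \<in> bounded_operators \<Longrightarrow> A o\<^sub>L (c *\<^sub>C B) = c *\<^sub>C (A o\<^sub>L B)"
  "(c *\<^sub>C A) o\<^sub>L B = c *\<^sub>C (A o\<^sub>L B)"
  by (auto intro!: blinfun_eqI simp: scaleC_blinfun.rep_eq bounded_operators_def)

lemma blinfun_compose_assoc: "(A o\<^sub>L B) o\<^sub>L C = A o\<^sub>L (B o\<^sub>L C)"
  by (rule blinfun_eqI) simp

lemma blinfun_compose_id [simp]: "A o\<^sub>L id_blinfun = A" "id_blinfun o\<^sub>L A = A"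
  by (auto intro!: blinfun_eqI)

primrec blinfun_power :: "('v::real_normed_vector \<Rightarrow>\<^sub>L 'v) \<Rightarrow> nat \<Rightarrow> 'v \<Rightarrow>\<^sub>L 'v"
  where "blinfun_power A 0 = id_blinfun"
  | "blinfun_power A (Suc n) = A o\<^sub>L blinfun_power A n"

lemma norm_blinfun_power: "norm (blinfun_power A n) \<le> norm A ^ n"
proof (induction n)
  case 0 then show ?case using norm_blinfun_id_le by simp
next
  case (Suc n)
  have "norm (A o\<^sub>L blinfun_power A n) \<le> norm A * norm (blinfun_power A n)"
    by (rule norm_blinfun_compose)
  with Suc show ?case by (simp add: order_trans[OF _ mult_left_mono])
qed

lemma blinfun_power_commute: "blinfun_power A n o\<^sub>L A = A o\<^sub>L blinfun_power A n"
  by (induction n) (simp_all add: blinfun_compose_assoc)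

lemma blinfun_power_bounded_operators:
  "A \<in> bounded_operators \<Longrightarrow> blinfun_power A n \<in> bounded_operators"
  by (induction n) (auto simp: bounded_operators_def)

definition neumann_term :: "('v::complex_banach \<Rightarrow>\<^sub>L 'v) \<Rightarrow> complex \<Rightarrow> nat \<Rightarrow> 'v \<Rightarrow>\<^sub>L 'v"
  where "neumann_term A z n = (1 / z ^ (n + 1)) *\<^sub>C blinfun_power A n"

lemma norm_neumann_term:
  assumes "0 < r" "r \<le> norm z"
  shows "norm (neumann_term A z n) \<le> (norm A / r) ^ n / r"
proof -
  have "norm (neumann_term A z n) = norm (blinfun_power A n) / norm z ^ (n + 1)"
    by (simp add: neumann_term_def norm_scaleC norm_divide norm_power norm_mult)
  also have "\<dots> \<le> norm A ^ n / r ^ (n + 1)"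
    using assms by (intro frac_le norm_blinfun_power power_mono) auto
  finally show ?thesis by (simp add: power_divide mult.commute)
qed

lemma summable_neumann_bound:
  fixes A :: "'v::real_normed_vector"
  assumes "norm A < r"
  shows "summable (\<lambda>n. (norm A / r) ^ n / r)"
  using assms norm_ge_zero[of A] by (intro summable_divide summable_geometric) (auto simp: divide_less_eq)

lemma summable_neumann_term:
  assumes "norm A < norm z"
  shows "summable (neumann_term A z)"
proof (rule summable_comparison_test')
  show "summable (\<lambda>n. (norm A / norm z) ^ n / norm z)"
    using summable_neumann_bound[OF assms] .
  show "norm (neumann_term A z n) \<le> (norm A / norm z) ^ n / norm z" if "n \<ge> 0" for n
    using assms norm_ge_zero[of A] by (intro norm_neumann_term) auto
qed

text \<open>Multiplying the term of index \<open>n + 1\<close> by \<open>z\<close> amounts to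
  applying \<open>A\<close> to the term of index \<open>n\<close>. Summation gives
  \<open>z *\<^sub>C S - id_blinfun\<close> for \<open>A o\<^sub>L S\<close>, and for the other
  order as \<open>A\<close> commutes with its powers.\<close>

lemma is_resolvent_neumann:
  assumes A: "A \<in> bounded_operators" and z: "norm A < norm z"
  shows "is_resolvent A z (suminf (neumann_term A z))"
proof -
  let ?S = "suminf (neumann_term A z)"
  have z0: "z \<noteq> 0" using z norm_ge_zero[of A] by auto
  note s = summable_neumann_term[OF z]
  have shift: "z *\<^sub>C neumann_term A z (Suc n) = A o\<^sub>L neumann_term A z n" for n
    using z0 by (simp add: neumann_term_def scaleC_scaleC blinfun_compose_scaleC A)
  have comm: "neumann_term A z n o\<^sub>L A = A o\<^sub>L neumann_term A z n" for n
    by (simp add: neumann_term_def blinfun_compose_scaleC A blinfun_power_commute)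
  have "(\<Sum>n. z *\<^sub>C neumann_term A z (Suc n)) = z *\<^sub>C (\<Sum>n. neumann_term A z (Suc n))"
    by (rule bounded_linear.suminf[OF bounded_linear_scaleC, symmetric])
      (use s in \<open>simp add: summable_Suc_iff\<close>)
  also have "\<dots> = z *\<^sub>C (?S - neumann_term A z 0)"
    using suminf_split_head[OF s] by simp
  also have "\<dots> = z *\<^sub>C ?S - id_blinfun"
    using z0 by (simp add: scaleC_diff_right
        neumann_term_def scaleC_scaleC)
  finally have sum: "(\<Sum>n. z *\<^sub>C neumann_term A z (Suc n)) = z *\<^sub>C ?S - id_blinfun" .
  have AS: "A o\<^sub>L ?S = z *\<^sub>C ?S - id_blinfun"
    using bounded_linear.suminf[OF bounded_bilinear.bounded_linear_right[OF bounded_bilinear_blinfun_compose, of A] s]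
      sum by (simp add: shift)
  have SA: "?S o\<^sub>L A = z *\<^sub>C ?S - id_blinfun"
    using bounded_linear.suminf[OF bounded_bilinear.bounded_linear_left[OF bounded_bilinear_blinfun_compose, of A] s]
      sum by (simp add: shift comm)
  \<comment> \<open>Evaluation at a vector is continuous in the operator, so complex linearity
    passes from the terms to the sum.\<close>
  have S: "?S \<in> bounded_operators"
    unfolding bounded_operators_def
  proof (intro CollectI allI)
    fix c x
    have apply_sum: "blinfun_apply ?S y = (\<Sum>n. blinfun_apply (neumann_term A z n) y)" for y
      by (rule bounded_linear.suminf[OF blinfun.bounded_linear_left s])
    have sx: "summable (\<lambda>n. blinfun_apply (neumann_term A z n) x)"
      by (rule bounded_linear.summable[OF blinfun.bounded_linear_left s])
    have "blinfun_apply (neumann_term A z n) (c *\<^sub>C x) = c *\<^sub>C blinfun_apply (neumann_term A z n) x" for n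
      using blinfun_power_bounded_operators[OF A, of n]
      by (simp add: neumann_term_def scaleC_blinfun.rep_eq bounded_operators_def scaleC_scaleC mult.commute)
    then show "blinfun_apply ?S (c *\<^sub>C x) = c *\<^sub>C blinfun_apply ?S x"
      by (simp add: apply_sum bounded_linear.suminf[OF bounded_linear_scaleC sx])
  qed
  have "(z *\<^sub>C id_blinfun - A) o\<^sub>L ?S = z *\<^sub>C ?S - (A o\<^sub>L ?S)"
    by (rule blinfun_eqI) (simp add: blinfun.diff_left scaleC_blinfun.rep_eq)
  moreover have "?S o\<^sub>L (z *\<^sub>C id_blinfun - A) = z *\<^sub>C ?S - (?S o\<^sub>L A)"
    using S by (intro blinfun_eqI)
      (simp add: blinfun.diff_left blinfun.diff_right scaleC_blinfun.rep_eq bounded_operators_def)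
  ultimately show ?thesis using S AS SA by (simp add: is_resolvent_def)
qed

text \<open>A left inverse equals a right inverse; this justifies the \<open>THE\<close> in
  \<open>resolvent\<close>.\<close>

lemma is_resolvent_unique:
  assumes "is_resolvent A z B" "is_resolvent A z B'"
  shows "B = B'"
proof -
  have "B o\<^sub>L ((z *\<^sub>C id_blinfun - A) o\<^sub>L B') = (B o\<^sub>L (z *\<^sub>C id_blinfun - A)) o\<^sub>L B'"
    by (simp add: blinfun_compose_assoc)
  with assms show ?thesis by (simp add: is_resolvent_def)
qed

lemma resolvent_eq_neumann:
  assumes "A \<in> bounded_operators" "norm A < norm z"
  shows "z \<in> resolvent_set A" "resolvent A z = suminf (neumann_term A z)"
  using is_resolvent_neumann[OF assms] is_resolvent_unique
  unfolding resolvent_set_def resolvent_def by blast+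

text \<open>The tail is dominated term by term by a geometric tail free of \<open>z\<close>, so the
  error is uniform outside the disc of radius \<open>r\<close>.\<close>

lemma resolvent_neumann_error:
  assumes A: "A \<in> bounded_operators" and r: "norm A < r" "r \<le> norm z"
  shows "norm (resolvent A z - (\<Sum>n<N. neumann_term A z n)) \<le> (\<Sum>n. (norm A / r) ^ (n + N) / r)"
proof -
  have r0: "0 < r" using r norm_ge_zero[of A] by linarith
  have z: "norm A < norm z" using r by simp
  have "resolvent A z - (\<Sum>n<N. neumann_term A z n) = (\<Sum>n. neumann_term A z (n + N))"
    using resolvent_eq_neumann(2)[OF A z] suminf_minus_initial_segment[OF summable_neumann_term[OF z], of N] by simp
  also have "norm \<dots> \<le> (\<Sum>n. (norm A / r) ^ (n + N) / r)"
    using norm_neumann_term[OF r0 r(2)] summable_ignore_initial_segment[OF summable_neumann_bound[OF r(1)], of N]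
    by (intro norm_suminf_le) auto
  finally show ?thesis .
qed

section \<open>Moments of test functions vanishing near the origin\<close>

text \<open>The pole at \<open>0\<close> is harmless because \<open>\<phi>\<close> vanishes on a
  disc around it. Elsewhere \<open>1 / z ^ m\<close> is holomorphic, so its \<open>dy\<close> is
  \<open>\<i>\<close> times its \<open>dx\<close>.\<close>

lemma test_function_divide_power:
  assumes \<phi>: "\<phi> \<in> test_functions" and r: "0 < r" "\<And>z. norm z < r \<Longrightarrow> \<phi> z = 0"
  shows "(\<lambda>z. \<phi> z / z ^ m) \<in> test_functions"
    and "dx (\<lambda>z. \<phi> z / z ^ m) z = dx \<phi> z / z ^ m - of_nat m * \<phi> z / z ^ (m + 1)"
    and "dy (\<lambda>z. \<phi> z / z ^ m) z = dy \<phi> z / z ^ m - \<i> * of_nat m * \<phi> z / z ^ (m + 1)"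
proof -
  have near0: "z \<notin> fun_support f" if "norm z < r" "\<And>z. norm z < r \<Longrightarrow> f z = 0" for f z
  proof -
    have "fun_support f \<subseteq> - ball 0 r" using that(2) by (intro fun_support_minimal) auto
    with that(1) show ?thesis by auto
  qed
  \<comment> \<open>General in \<open>f\<close> and \<open>m\<close>, because the induction below
    passes to \<open>dx f\<close>, \<open>dy f\<close> and to higher powers. At \<open>0\<close> all
    numerators vanish, so the formula holds there too.\<close>
  have D: "((\<lambda>z. f z / z ^ m) has_derivative (\<lambda>v. (Re v *\<^sub>R dx f z + Im v *\<^sub>R dy f z) / z ^ m
      - of_nat m * v * f z / z ^ (m + 1))) (at z)"
    if "f differentiable (at z)" "\<And>z. norm z < r \<Longrightarrow> f z = 0" for f z m
  proof (cases "z = 0")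
    case True
    have "f 0 = 0" "dx f 0 = 0" "dy f 0 = 0"
      using that(2)[of 0] r(1) dx_dy_zero_outside_support[OF near0[of 0 f]] that(2) by auto
    moreover have "((\<lambda>z. f z / z ^ m) has_derivative (\<lambda>v. 0)) (at 0)"
      by (rule has_derivative_transform_within_open[OF has_derivative_const[of 0], of "ball 0 r"])
        (use r that(2) in auto)
    ultimately show ?thesis using True by simp
  next
    case False
    have P: "((\<lambda>z. inverse (z ^ m)) has_derivative (\<lambda>v. v * (- of_nat m / z ^ (m + 1)))) (at z)"
    proof -
      have "((\<lambda>z. inverse (z ^ m)) has_field_derivative (- of_nat m / z ^ (m + 1))) (at z)"
      proof (cases m)
        case (Suc k)
        have "((\<lambda>z. z ^ Suc k) has_field_derivative of_nat (Suc k) * z ^ k) (at z)"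
          using DERIV_power[OF DERIV_ident, where n = "Suc k"] by simp
        from DERIV_inverse_fun[OF this] False show ?thesis
          unfolding Suc by (auto elim!: DERIV_cong simp: field_simps)
      qed simp
      then show ?thesis
        unfolding has_field_derivative_def by (rule has_derivative_eq_rhs) (simp add: fun_eq_iff)
    qed
    from has_derivative_mult[OF has_derivative_dx_dy[OF that(1)] P] show ?thesis
      by (simp add: divide_inverse algebra_simps)
  qed
  have vd: "dx f z = 0" "dy f z = 0" if "norm z < r" "\<And>z. norm z < r \<Longrightarrow> f z = 0" for f z
    using dx_dy_zero_outside_support[OF near0[OF that]] by auto
  have "Ck k (\<lambda>z. f z / z ^ m)" if "Ck k f" "\<And>z. norm z < r \<Longrightarrow> f z = 0" for k f m
    using that
  proof (induction k arbitrary: f m)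
    case 0
    \<comment> \<open>The disc, where the quotient is \<open>0\<close>, and the punctured plane are
      open and cover \<complex>.\<close>
    have "continuous_on (ball 0 r \<union> - {0}) (\<lambda>z. f z / z ^ m)"
    proof (rule continuous_on_open_Un)
      show "continuous_on (ball 0 r) (\<lambda>z. f z / z ^ m)"
        by (rule continuous_on_eq[OF continuous_on_const[of _ 0]]) (simp add: 0(2))
      show "continuous_on (- {0}) (\<lambda>z. f z / z ^ m)"
        using 0(1) by (intro continuous_intros) (auto intro: continuous_on_subset)
    qed auto
    moreover have "ball 0 r \<union> - {0} = (UNIV :: complex set)" using r by auto
    ultimately show ?case by simp
  next
    case (Suc k)
    then have d: "f differentiable (at z)" "Ck k (dx f)" "Ck k (dy f)" for z by auto
    have f: "Ck k f" using Suc.prems(1) by (rule Ck_Suc_imp)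
    note D' = D[OF d(1) Suc.prems(2)]
    have e: "dx (\<lambda>z. f z / z ^ m) = (\<lambda>z. dx f z / z ^ m + (- of_nat m) * (f z / z ^ (m + 1)))"
      "dy (\<lambda>z. f z / z ^ m) = (\<lambda>z. dy f z / z ^ m + (- \<i> * of_nat m) * (f z / z ^ (m + 1)))"
      by (auto simp: dx_eq[OF D'] dy_eq[OF D'] mult.commute)
    have "Ck k (dx (\<lambda>z. f z / z ^ m))" "Ck k (dy (\<lambda>z. f z / z ^ m))"
      unfolding e using Suc.prems(2) by (intro Ck_add Ck_mult Ck_const Suc.IH d f vd; blast)+
    moreover have "(\<lambda>z. f z / z ^ m) differentiable (at z)" for z
      using D' unfolding differentiable_def by blast
    ultimately show ?case by simp
  qed
  then show "(\<lambda>z. \<phi> z / z ^ m) \<in> test_functions"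
    using \<phi> r by (intro test_functionsI[of _ "fun_support \<phi>"]) (auto intro: test_functionsD simp: zero_outside_support)
  note D' = D[OF test_functionsD(3)[OF \<phi>] r(2)]
  show "dx (\<lambda>z. \<phi> z / z ^ m) z = dx \<phi> z / z ^ m - of_nat m * \<phi> z / z ^ (m + 1)"
    "dy (\<lambda>z. \<phi> z / z ^ m) z = dy \<phi> z / z ^ m - \<i> * of_nat m * \<phi> z / z ^ (m + 1)"
    by (simp_all add: dx_eq[OF D'] dy_eq[OF D'] mult.commute)
qed

text \<open>By holomorphy, division by \<open>z ^ m\<close> commutes with \<open>dbar\<close>: the
  terms with \<open>of_nat m\<close> cancel because \<open>1 + \<i> * \<i> = 0\<close>.\<close>

lemma integral_dbar_divide_power:
  assumes "\<phi> \<in> test_functions" "0 < r" "\<And>z. norm z < r \<Longrightarrow> \<phi> z = 0"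
  shows "(LINT z|lborel. dbar \<phi> z / z ^ m) = 0"
proof -
  note q = test_function_divide_power[OF assms]
  have "(\<lambda>z. dbar \<phi> z / z ^ m) = dbar (\<lambda>z. \<phi> z / z ^ m)"
    by (rule ext) (simp add: dbar_def q(2,3) algebra_simps add_divide_distrib diff_divide_distrib)
  then show ?thesis by (simp only: integral_dbar[OF q(1)])
qed

text \<open>If \<open>G\<close> is radial then \<open>F z = G z / z ^ n\<close> is an eigenfunction of the generator
  \<open>x \<partial>\<^sub>y - y \<partial>\<^sub>x\<close> of rotations for the eigenvalue \<open>- \<i> n\<close>, and the image of that
  generator integrates to zero.\<close>

lemma integral_radial_divide_power:
  assumes G: "G \<in> test_functions" and r: "0 < r" "\<And>z. norm z < r \<Longrightarrow> G z = 0"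
    and radial: "\<And>z. of_real (Re z) * dy G z = of_real (Im z) * dx G z" and "n \<noteq> 0"
  shows "(LINT z|lborel. G z / z ^ n) = 0"
proof -
  define F where "F z = G z / z ^ n" for z
  have F: "F \<in> test_functions" and dF: "dx F z = dx G z / z ^ n - of_nat n * G z / z ^ (n + 1)"
    "dy F z = dy G z / z ^ n - \<i> * of_nat n * G z / z ^ (n + 1)" for z
    using test_function_divide_power[OF G r, of n] by (simp_all add: F_def[abs_def])
  have bl: "bounded_linear (\<lambda>z. complex_of_real (Re z))" "bounded_linear (\<lambda>z. complex_of_real (Im z))"
    by (rule bounded_linear_compose[OF bounded_linear_of_real bounded_linear_Re]
        bounded_linear_compose[OF bounded_linear_of_real bounded_linear_Im])+
  note d = bl[THEN bounded_linear_imp_has_derivative]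
  have t: "(\<lambda>z. of_real (Re z) * F z) \<in> test_functions" "(\<lambda>z. of_real (Im z) * F z) \<in> test_functions"
    using bl by (auto intro!: test_function_mult[OF F] Ck_bounded_linear)
  \<comment> \<open>\<open>Re z\<close> does not vary with \<open>y\<close>, nor \<open>Im z\<close>
    with \<open>x\<close>, so the generator applied to \<open>F\<close> is a difference of partial
    derivatives of test functions.\<close>
  have "dy (\<lambda>z. of_real (Re z) * F z) z = of_real (Re z) * dy F z" for z
    using dx_dy_mult(2)[OF bounded_linear_imp_differentiable[OF bl(1)] test_functionsD(3)[OF F]]
    by (simp add: dy_eq[OF d(1)])
  moreover have "dx (\<lambda>z. of_real (Im z) * F z) z = of_real (Im z) * dx F z" for z
    using dx_dy_mult(1)[OF bounded_linear_imp_differentiable[OF bl(2)] test_functionsD(3)[OF F]]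
    by (simp add: dx_eq[OF d(2)])
  moreover have "of_real (Re z) * dy F z - of_real (Im z) * dx F z = - \<i> * of_nat n * F z" for z
  proof (cases "z = 0")
    case True
    then show ?thesis using \<open>n \<noteq> 0\<close> by (simp add: F_def)
  next
    case False
    \<comment> \<open>Radiality removes the derivatives of \<open>G\<close>; what is left comes from
      differentiating \<open>1 / z ^ n\<close>.\<close>
    have "of_real (Re z) * dy F z - of_real (Im z) * dx F z
      = (of_real (Re z) * dy G z - of_real (Im z) * dx G z) / z ^ n
        - \<i> * of_nat n * G z / z ^ (n + 1) * (of_real (Re z) + \<i> * of_real (Im z))"
      by (simp add: dF algebra_simps diff_divide_distrib)
    also have "of_real (Re z) + \<i> * of_real (Im z) = z" by (simp add: complex_eq_iff)
    also have "(of_real (Re z) * dy G z - of_real (Im z) * dx G z) / z ^ n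
        - \<i> * of_nat n * G z / z ^ (n + 1) * z = - \<i> * of_nat n * F z"
      using False by (simp add: radial F_def)
    finally show ?thesis .
  qed
  ultimately have "(\<lambda>z. - \<i> * of_nat n * F z)
    = (\<lambda>z. dy (\<lambda>z. of_real (Re z) * F z) z - dx (\<lambda>z. of_real (Im z) * F z) z)"
    by (simp add: fun_eq_iff)
  then have "(LINT z|lborel. - \<i> * of_nat n * F z) = 0"
    using integral_dx_dy(2)[OF t(1)] integral_dx_dy(1)[OF t(2)]
      integrable_test_function[OF test_function_dx_dy(2)[OF t(1)]]
      integrable_test_function[OF test_function_dx_dy(1)[OF t(2)]] by simp
  moreover have "(LINT z|lborel. - \<i> * of_nat n * F z) = - \<i> * of_nat n * (LINT z|lborel. F z)"
    by (rule integral_mult_right_zero)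
  ultimately show ?thesis using \<open>n \<noteq> 0\<close> by (simp add: F_def)
qed

section \<open>The radial cutoff function and its moments\<close>

lemma dx_dy_norm_power2:
  "(\<lambda>z. of_real ((norm z)\<^sup>2) :: complex) differentiable (at z)"
  "dx (\<lambda>z. of_real ((norm z)\<^sup>2)) z = 2 * of_real (Re z)"
  "dy (\<lambda>z. of_real ((norm z)\<^sup>2)) z = 2 * of_real (Im z)"
proof -
  have "((\<lambda>z. z * cnj z) has_derivative (\<lambda>v. z * cnj v + v * cnj z)) (at z)"
    by (intro has_derivative_mult has_derivative_ident
        bounded_linear_imp_has_derivative[OF bounded_linear_cnj])
  then have *: "((\<lambda>z. of_real ((norm z)\<^sup>2)) has_derivative (\<lambda>v. z * cnj v + v * cnj z)) (at z)"
    by (simp only: complex_norm_square)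
  then show "(\<lambda>z. of_real ((norm z)\<^sup>2) :: complex) differentiable (at z)"
    unfolding differentiable_def by blast
  show "dx (\<lambda>z. of_real ((norm z)\<^sup>2)) z = 2 * of_real (Re z)"
    "dy (\<lambda>z. of_real ((norm z)\<^sup>2)) z = 2 * of_real (Im z)"
    by (simp_all add: dx_eq[OF *] dy_eq[OF *] complex_eq_iff del: of_real_power)
qed

text \<open>Chain rule, with \<open>z\<close> as the \<open>dbar\<close> of \<open>|z|^2\<close>.
  This factor later cancels one power of \<open>z\<close> in the moments.\<close>

lemma dbar_bump:
  "dbar (\<lambda>z. of_real (bump a b ((norm z)\<^sup>2))) z = of_real (bump_deriv a b ((norm z)\<^sup>2)) * z"
proof -
  have eq: "of_real (Re z) + \<i> * of_real (Im z) = z" by (simp add: complex_eq_iff)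
  have "(g * (2 * x) + \<i> * (g * (2 * y))) / 2 = g * (x + \<i> * y)" for g x y
    by (simp add: field_simps)
  then show ?thesis
    unfolding dbar_def
      dx_dy_compose_real(2,3)[where u = "\<lambda>z. (norm z)\<^sup>2", OF bump_has_deriv dx_dy_norm_power2(1)]
      dx_dy_norm_power2
    by (simp only: eq)
qed

text \<open>Existence is enough: in the radiality condition the derivative is a common factor of
  both sides.\<close>

lemma bump_deriv_differentiable: "\<exists>h'. (bump_deriv a b has_real_derivative h') (at s)"
proof -
  have 1: "((\<lambda>s. exp_recip n (s - a)) has_real_derivative
      (exp_recip (n + 2) (s - a) - n * exp_recip (n + 1) (s - a)) * 1) (at s)" for n
    by (rule DERIV_chain2[OF exp_recip_deriv]) (auto intro!: derivative_eq_intros)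
  note 2 = DERIV_diff[OF DERIV_const DERIV_cdivide[OF 1]]
  show ?thesis
    unfolding bump_deriv_def[abs_def]
    by (rule exI, rule DERIV_minus, rule DERIV_cmult, rule DERIV_mult,
        rule DERIV_chain2[OF exp_recip_deriv 2], rule 1)
qed

lemma integral_dbar_bump_divide_power:
  assumes "0 < a" "a < b"
  shows "(LINT z|lborel. dbar (\<lambda>z. of_real (bump a b ((norm z)\<^sup>2))) z / z ^ (n + 1))
    = (if n = 0 then - of_real pi else 0)"
proof -
  define G where "G z = complex_of_real (bump_deriv a b ((norm z)\<^sup>2))" for z :: complex
  have G: "G \<in> test_functions"
    using test_function_bump(2)[OF assms(2), of 0] by (simp add: G_def[abs_def])
  have G0: "G z = 0" if "norm z < sqrt a" for z
    using that real_sqrt_less_iff[of "(norm z)\<^sup>2" a] by (simp add: G_def bump_deriv_eq_0)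
  \<comment> \<open>At \<open>0\<close> both sides are \<open>0\<close>, since \<open>0 < a\<close>
    makes \<open>G\<close> vanish there.\<close>
  have "dbar (\<lambda>z. of_real (bump a b ((norm z)\<^sup>2))) z / z ^ (n + 1) = G z / z ^ n" for z
    using G0[of 0] assms by (cases "z = 0") (simp_all add: dbar_bump G_def)
  then have *: "(LINT z|lborel. dbar (\<lambda>z. of_real (bump a b ((norm z)\<^sup>2))) z / z ^ (n + 1))
    = (LINT z|lborel. G z / z ^ n)" by simp
  show ?thesis
  proof (cases "n = 0")
    case True
    then show ?thesis
      using integral_bump_deriv[OF assms] unfolding * by (simp add: G_def)
  next
    case False
    have "of_real (Re z) * dy G z = of_real (Im z) * dx G z" for z
    proof -
      obtain h' where h: "(bump_deriv a b has_real_derivative h') (at ((norm z)\<^sup>2))"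
        using bump_deriv_differentiable by blast
      show ?thesis
        unfolding G_def[abs_def]
          dx_dy_compose_real(2,3)[where u = "\<lambda>z. (norm z)\<^sup>2", OF h dx_dy_norm_power2(1)]
          dx_dy_norm_power2 by simp
    qed
    with False assms show ?thesis
      unfolding * by (subst integral_radial_divide_power[OF G, of "sqrt a"]) (auto simp: G0)
  qed
qed

section \<open>The spectral distribution\<close>

text \<open>Every nonempty partial sum of the Laurent series integrates against
  \<open>\<phi>\<close> exactly to \<open>c\<close> times the identity, as only index
  \<open>0\<close> survives. The remainder is uniformly small where \<open>\<phi>\<close> lives, so
  its integral tends to \<open>0\<close>.\<close>

lemma extends_resolvent_moments:
  fixes A :: "'v::complex_banach \<Rightarrow>\<^sub>L 'v"
  assumes A: "A \<in> bounded_operators" and R: "extends_resolvent A R"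
    and \<phi>: "\<phi> \<in> test_functions" and r: "norm A < r" "\<And>z. norm z < r \<Longrightarrow> \<phi> z = 0"
    and moments: "\<And>n. (LINT z|lborel. \<phi> z / z ^ (n + 1)) = (if n = 0 then c else 0)"
  shows "R \<phi> = c *\<^sub>C id_blinfun"
proof -
  have r0: "0 < r" using r(1) norm_ge_zero[of A] by linarith
  have "fun_support \<phi> \<subseteq> - ball 0 r"
    using r(2) by (intro fun_support_minimal) auto
  then have "fun_support \<phi> \<subseteq> resolvent_set A"
    using resolvent_eq_neumann(1)[OF A] r(1) by force
  with R \<phi> have I: "((\<lambda>z. \<phi> z *\<^sub>C resolvent A z) has_integral R \<phi>) UNIV"
    unfolding extends_resolvent_def by blast
  obtain b where b: "fun_support \<phi> \<subseteq> cbox (- b) b"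
    using bounded_subset_cbox_symmetric compact_imp_bounded[OF test_functionsD(2)[OF \<phi>]] by metis
  obtain B where B: "B > 0" "\<And>z. norm (\<phi> z) \<le> B"
    by (rule test_function_bounded[OF \<phi>]) (rule that)
  define e where "e N = (\<Sum>n. (norm A / r) ^ (n + N) / r)" for N
  \<comment> \<open>\<open>Suc N\<close> keeps index \<open>0\<close> in every partial sum. The
    volume of a box around the support turns the uniform bound into a bound on the integral.\<close>
  have le: "norm (R \<phi> - c *\<^sub>C id_blinfun) \<le> B * e (Suc N) * measure lborel (cbox (- b) b)" for N
  proof -
    have "((\<lambda>z. (\<phi> z / z ^ (n + 1)) *\<^sub>C blinfun_power A n) has_integral
      (if n = 0 then c else 0) *\<^sub>C blinfun_power A n) UNIV" for n
    proof -
      have "integrable lborel (\<lambda>z. \<phi> z / z ^ (n + 1))"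
        by (intro integrable_test_function test_function_divide_power(1)[OF \<phi> r0]) (rule r(2))
      from has_integral_linear[OF has_integral_integral_lborel[OF this] bounded_linear_scaleC_left]
      show ?thesis unfolding moments o_def .
    qed
    then have "((\<lambda>z. \<Sum>n<Suc N. (\<phi> z / z ^ (n + 1)) *\<^sub>C blinfun_power A n) has_integral
      (\<Sum>n<Suc N. (if n = 0 then c else 0) *\<^sub>C blinfun_power A n)) UNIV"
      by (intro has_integral_sum) auto
    also have "(\<Sum>n<Suc N. (if n = 0 then c else 0) *\<^sub>C blinfun_power A n) = c *\<^sub>C id_blinfun"
      by (simp add: sum.lessThan_Suc_shift del: sum.lessThan_Suc)
    also have "(\<lambda>z. \<Sum>n<Suc N. (\<phi> z / z ^ (n + 1)) *\<^sub>C blinfun_power A n)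
      = (\<lambda>z. \<phi> z *\<^sub>C (\<Sum>n<Suc N. neumann_term A z n))"
      by (simp add: neumann_term_def scaleC_scaleC scaleC_sum_right
          del: sum.lessThan_Suc)
    finally have int: "((\<lambda>z. \<phi> z *\<^sub>C (resolvent A z - (\<Sum>n<Suc N. neumann_term A z n)))
      has_integral (R \<phi> - c *\<^sub>C id_blinfun)) UNIV"
      using has_integral_diff[OF I]
      by (simp add: scaleC_diff_right del: sum.lessThan_Suc)
    have "\<phi> z = 0" if "z \<notin> cbox (- b) b" for z
      using b that zero_outside_support by blast
    then have eq: "(\<lambda>z. \<phi> z *\<^sub>C (resolvent A z - (\<Sum>n<Suc N. neumann_term A z n)))
      = (\<lambda>z. if z \<in> cbox (- b) b then \<phi> z *\<^sub>C (resolvent A z - (\<Sum>n<Suc N. neumann_term A z n)) else 0)"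
      by (intro ext) (auto simp del: sum.lessThan_Suc)
    have "((\<lambda>z. \<phi> z *\<^sub>C (resolvent A z - (\<Sum>n<Suc N. neumann_term A z n)))
      has_integral (R \<phi> - c *\<^sub>C id_blinfun)) (cbox (- b) b)"
      by (rule has_integral_restrict_UNIV[THEN iffD1,
            OF subst[where P = "\<lambda>g. (g has_integral _) UNIV", OF eq int]])
    \<comment> \<open>On the disc \<open>\<phi>\<close> vanishes and it suffices that
      \<open>e (Suc N)\<close> is nonnegative; outside, the Neumann error estimate applies.\<close>
    moreover have bound: "norm (\<phi> z *\<^sub>C (resolvent A z - (\<Sum>n<Suc N. neumann_term A z n))) \<le> B * e (Suc N)" for z
    proof (cases "norm z < r")
      case True
      have "0 \<le> e (Suc N)"
        unfolding e_def using r0 summable_ignore_initial_segment[OF summable_neumann_bound[OF r(1)]]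
        by (intro suminf_nonneg) auto
      with True r(2) B show ?thesis by (simp add: norm_scaleC)
    next
      case False
      then show ?thesis
        using resolvent_neumann_error[OF A r(1), of z "Suc N"] B unfolding norm_scaleC e_def
        by (intro mult_mono) auto
    qed
    ultimately show ?thesis
      using order_trans[OF norm_ge_zero bound] by (intro has_integral_bound) auto
  qed
  have "e \<longlonglongrightarrow> 0"
    using suminf_exist_split2[OF summable_neumann_bound[OF r(1)]] unfolding e_def[abs_def] .
  then have "(\<lambda>N. B * e (Suc N) * measure lborel (cbox (- b) b)) \<longlonglongrightarrow> B * 0 * measure lborel (cbox (- b) b)"
    by (intro tendsto_intros LIMSEQ_Suc)
  then have "norm (R \<phi> - c *\<^sub>C id_blinfun) \<le> B * 0 * measure lborel (cbox (- b) b)"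
    by (rule LIMSEQ_le_const) (use le in blast)
  then show ?thesis by simp
qed

section \<open>The support of the spectral distribution and its value at one\<close>

lemma spectral_distribution_add:
  assumes "operator_distribution R" "\<phi> \<in> test_functions" "\<psi> \<in> test_functions"
  shows "spectral_distribution R (\<lambda>z. \<phi> z + \<psi> z) = spectral_distribution R \<phi> + spectral_distribution R \<psi>"
proof -
  have "dbar (\<lambda>z. \<phi> z + \<psi> z) = (\<lambda>z. dbar \<phi> z + dbar \<psi> z)"
    using assms(2,3) by (auto simp: dbar_def dx_dy_add test_functionsD field_simps)
  with assms show ?thesis
    by (simp add: spectral_distribution_def dist_dbar_def operator_distribution_def test_function_dbar
        flip: scaleC_add_right)
qed

lemma dist_support_spectral_distribution:
  fixes A :: "'v::complex_banach \<Rightarrow>\<^sub>L 'v"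
  assumes A: "A \<in> bounded_operators" and R: "extends_resolvent A R"
  shows "dist_support (spectral_distribution R) \<subseteq> cball 0 (norm A)"
proof -
  have "spectral_distribution R \<phi> = 0"
    if \<phi>: "\<phi> \<in> test_functions" and supp: "fun_support \<phi> \<subseteq> - cball 0 (norm A)" for \<phi>
  proof -
    \<comment> \<open>A compact support keeps a positive distance from the disc, so its smallest
      modulus serves as \<open>r\<close>; if it is empty, any radius above \<open>norm A\<close>
      does.\<close>
    obtain r where r: "norm A < r" "\<And>z. norm z < r \<Longrightarrow> z \<notin> fun_support \<phi>"
    proof (cases "fun_support \<phi> = {}")
      case True
      then show ?thesis using that[of "norm A + 1"] by simp
    next
      case False
      obtain w where "w \<in> fun_support \<phi>" "\<forall>z\<in>fun_support \<phi>. norm w \<le> norm z"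
        using continuous_attains_inf[OF test_functionsD(2)[OF \<phi>] False continuous_on_norm_id] by blast
      with supp show ?thesis by (intro that[of "norm w"]) (auto simp: not_less)
    qed
    have "0 < r" using r(1) norm_ge_zero[of A] by linarith
    \<comment> \<open>The two equal branches match the moment condition with
      \<open>c = 0\<close>.\<close>
    then have "(LINT z|lborel. dbar \<phi> z / z ^ (n + 1)) = (if n = 0 then 0 else 0)" for n
      using integral_dbar_divide_power[OF \<phi>, of r "n + 1"] r(2) zero_outside_support[of _ \<phi>] by simp
    moreover have "dbar \<phi> z = 0" if "norm z < r" for z
      using dx_dy_zero_outside_support[OF r(2)[OF that]] by (simp add: dbar_def)
    ultimately have "R (dbar \<phi>) = 0 *\<^sub>C id_blinfun"
      by (intro extends_resolvent_moments[OF A R test_function_dbar[OF \<phi>] r(1)])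
    then show ?thesis
      by (simp add: spectral_distribution_def dist_dbar_def)
  qed
  then have "- cball 0 (norm A) \<subseteq> \<Union>{U. open U \<and>
      (\<forall>\<phi>\<in>test_functions. fun_support \<phi> \<subseteq> U \<longrightarrow> spectral_distribution R \<phi> = 0)}"
    by (intro Union_upper) (auto simp: open_Compl)
  then show ?thesis unfolding dist_support_def by blast
qed

text \<open>The surviving moment is \<open>- pi\<close>; the sign in \<open>dist_dbar\<close> and
  the factor \<open>1 / pi\<close> turn it into \<open>1\<close>.\<close>

lemma spectral_distribution_bump:
  fixes A :: "'v::complex_banach \<Rightarrow>\<^sub>L 'v"
  assumes A: "A \<in> bounded_operators" and R: "extends_resolvent A R" and r: "norm A < r" "r\<^sup>2 < b"
  shows "spectral_distribution R (\<lambda>z. of_real (bump (r\<^sup>2) b ((norm z)\<^sup>2))) = id_blinfun"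
proof -
  let ?\<kappa> = "\<lambda>z. complex_of_real (bump (r\<^sup>2) b ((norm z)\<^sup>2))"
  have r0: "0 < r" using r(1) norm_ge_zero[of A] by linarith
  have "R (dbar ?\<kappa>) = (- of_real pi) *\<^sub>C id_blinfun"
  proof (rule extends_resolvent_moments[OF A R _ r(1)])
    show "dbar ?\<kappa> \<in> test_functions"
      using test_function_bump(1)[OF r(2), of 0] by (simp add: test_function_dbar)
    show "dbar ?\<kappa> z = 0" if "norm z < r" for z
      using that by (simp add: dbar_bump bump_deriv_eq_0 power_mono)
    show "(LINT z|lborel. dbar ?\<kappa> z / z ^ (n + 1)) = (if n = 0 then - of_real pi else 0)" for n
      using r0 r(2) by (intro integral_dbar_bump_divide_power) auto
  qed
  then show ?thesis
    by (simp add: spectral_distribution_def dist_dbar_def scaleC_scaleC scaleC_minus_left scaleC_minus_right)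
qed

theorem theorem1p8:
  fixes A :: "'v::complex_banach \<Rightarrow>\<^sub>L 'v"
    and R :: "(complex \<Rightarrow> complex) \<Rightarrow> 'v \<Rightarrow>\<^sub>L 'v"
  assumes "A \<in> bounded_operators"
    and "resolvent_distribution R"
    and "extends_resolvent A R"
  shows "compact (dist_support (spectral_distribution R)) \<and>
    has_value_at_one (spectral_distribution R) id_blinfun"
proof -
  let ?M = "spectral_distribution R"
  let ?S = "dist_support ?M"
  note add = spectral_distribution_add[of R]
  have R: "operator_distribution R" using assms(2) by (simp add: resolvent_distribution_def)
  have sub: "?S \<subseteq> cball 0 (norm A)"
    by (rule dist_support_spectral_distribution[OF assms(1,3)])
  have "closed ?S"
    unfolding dist_support_def by (intro closed_Compl open_Union) blast
  with sub have "compact ?S"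
    using compact_Int_closed[OF compact_cball] by (metis inf.absorb2)
  \<comment> \<open>A radius above \<open>norm A\<close>, so that the plateau of
    \<open>\<kappa>\<close> contains an open ball around the support.\<close>
  define r where "r = norm A + 1"
  define \<kappa> where "\<kappa> z = complex_of_real (bump (r\<^sup>2) (r\<^sup>2 + 1) ((norm z)\<^sup>2))" for z :: complex
  have \<kappa>: "\<kappa> \<in> test_functions"
    using test_function_bump(1)[of "r\<^sup>2" "r\<^sup>2 + 1" 0] by (simp add: \<kappa>_def[abs_def])
  have \<kappa>1: "\<kappa> z = 1" if "z \<in> ball 0 r" for z
    using that by (simp add: \<kappa>_def bump_eq_1 power_mono)
  have S_ball: "?S \<subseteq> ball 0 r"
    using sub by (auto simp: r_def)
  have M\<kappa>: "?M \<kappa> = id_blinfun"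
    unfolding \<kappa>_def[abs_def] by (rule spectral_distribution_bump[OF assms(1,3)]) (auto simp: r_def)
  have "\<kappa> \<in> cutoff_functions ?S"
    unfolding cutoff_functions_def using \<kappa> \<kappa>1 S_ball by (auto intro!: exI[of _ "ball 0 r"])
  moreover have "?M \<psi> = id_blinfun" if "\<psi> \<in> cutoff_functions ?S" for \<psi>
  proof -
    from that obtain U where \<psi>: "\<psi> \<in> test_functions" and U: "open U" "?S \<subseteq> U" "\<And>z. z \<in> U \<Longrightarrow> \<psi> z = 1"
      unfolding cutoff_functions_def by blast
    \<comment> \<open>Both functions are \<open>1\<close> on \<open>U \<inter> ball 0 r\<close>, an
      open neighbourhood of the support of \<open>?M\<close>, so their difference is supported off
      it.\<close>
    define \<phi> where "\<phi> z = \<psi> z + (- 1) * \<kappa> z" for z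
    have \<phi>: "\<phi> \<in> test_functions"
      unfolding \<phi>_def[abs_def] by (intro test_function_add \<psi> test_function_mult \<kappa> Ck_const)
    have "fun_support \<phi> \<subseteq> - (U \<inter> ball 0 r)"
      using U \<kappa>1 by (intro fun_support_minimal) (auto simp: \<phi>_def closed_Compl open_Int)
    with U(2) S_ball have "fun_support \<phi> \<inter> ?S = {}" by blast
    then have "?M \<phi> = 0"
      by (intro distribution_zero_off_support[OF add[OF R] \<phi>])
    moreover have "\<psi> = (\<lambda>z. \<phi> z + \<kappa> z)" by (simp add: \<phi>_def)
    ultimately show ?thesis using add[OF R \<phi> \<kappa>] M\<kappa> by simp
  qed
  ultimately show ?thesis
    using \<open>compact ?S\<close> unfolding has_value_at_one_def by blast
qed

end
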